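(* Let $Z\subset\mathbb{P}^2$ be a finite set of points and let $k\ge3$ be an integer. If $\alpha(I(kZ))-\alpha(I(Z))=k-1$, then the points of $Z$ are collinear.
   Context: Work over an algebraically closed field $\mathbb{K}$ of characteristic zero, $R=\mathbb{K}[x_0,x_1,x_2]$. For $Z=\{P_1,\dots,P_r\}\subset\mathbb{P}^2$, $I(P_i)$ is the homogeneous maximal ideal of $P_i$ and $I(kZ)=I(P_1)^k\cap\dots\cap I(P_r)^k$ (the $k$-th symbolic power of $I(Z)=I(1Z)$). For a homogeneous ideal $J$, $\alpha(J)=\min\{n:J_n\ne0\}$ is its initial degree. *)

theory Defs
  imports Main "HOL-Library.Poly_Mapping" "HOL-Library.Product_Plus"
    "HOL-Computational_Algebra.Polynomial"
begin

text \<open>Monomials x0^i x1^j x2^l of R = K[x0,x1,x2] are exponent triples (i,j,l);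
  a polynomial is a finitely supported map from monomials to coefficients,
  with the convolution product of Poly_Mapping.\<close>

type_synonym mono3 = "nat \<times> nat \<times> nat"
type_synonym 'a poly3 = "mono3 \<Rightarrow>\<^sub>0 'a"

definition mdeg :: "mono3 \<Rightarrow> nat" where
  "mdeg m = fst m + fst (snd m) + snd (snd m)"

definition eval3 :: "'a::comm_ring_1 poly3 \<Rightarrow> 'a \<times> 'a \<times> 'a \<Rightarrow> 'a" where
  "eval3 f P = (\<Sum>m\<in>Poly_Mapping.keys f. Poly_Mapping.lookup f m *
      fst P ^ fst m * fst (snd P) ^ fst (snd m) * snd (snd P) ^ snd (snd m))"

definition homogeneous :: "nat \<Rightarrow> 'a::zero poly3 \<Rightarrow> bool" where
  "homogeneous n f \<longleftrightarrow> (\<forall>m\<in>Poly_Mapping.keys f. mdeg m = n)"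

definition hcomp :: "nat \<Rightarrow> 'a::zero poly3 \<Rightarrow> 'a poly3" where
  "hcomp d f = Abs_poly_mapping (\<lambda>m. if mdeg m = d then Poly_Mapping.lookup f m else 0)"

inductive_set gen_ideal :: "'a::comm_ring_1 set \<Rightarrow> 'a set" for S where
  zero: "0 \<in> gen_ideal S"
| mult: "s \<in> S \<Longrightarrow> r * s \<in> gen_ideal S"
| add: "a \<in> gen_ideal S \<Longrightarrow> b \<in> gen_ideal S \<Longrightarrow> a + b \<in> gen_ideal S"

definition ideal_prod :: "'a::comm_ring_1 set \<Rightarrow> 'a set \<Rightarrow> 'a set" where
  "ideal_prod I J = gen_ideal {a * b | a b. a \<in> I \<and> b \<in> J}"

fun ideal_pow :: "'a::comm_ring_1 set \<Rightarrow> nat \<Rightarrow> 'a set" where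
  "ideal_pow I 0 = UNIV"
| "ideal_pow I (Suc k) = ideal_prod I (ideal_pow I k)"

text \<open>Points of P^2 are given by nonzero representatives; two representatives
  define the same point iff proportional.\<close>
definition same_point :: "'a::field \<times> 'a \<times> 'a \<Rightarrow> 'a \<times> 'a \<times> 'a \<Rightarrow> bool" where
  "same_point P Q \<longleftrightarrow> (\<exists>c. c \<noteq> 0 \<and> Q = (c * fst P, c * fst (snd P), c * snd (snd P)))"

definition ideal_pt :: "'a::field \<times> 'a \<times> 'a \<Rightarrow> 'a poly3 set" where
  "ideal_pt P = {f. \<forall>d. eval3 (hcomp d f) P = 0}"

definition ideal_fat :: "nat \<Rightarrow> ('a::field \<times> 'a \<times> 'a) set \<Rightarrow> 'a poly3 set" where
  "ideal_fat k Z = (\<Inter>P\<in>Z. ideal_pow (ideal_pt P) k)"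

definition init_deg :: "'a::zero poly3 set \<Rightarrow> nat" where
  "init_deg J = (LEAST n. \<exists>f\<in>J. f \<noteq> 0 \<and> homogeneous n f)"

definition alg_closed_field :: "'a::field itself \<Rightarrow> bool" where
  "alg_closed_field _ \<longleftrightarrow> (\<forall>p::'a poly. degree p > 0 \<longrightarrow> (\<exists>x. poly p x = 0))"

definition collinear3 :: "('a::field \<times> 'a \<times> 'a) set \<Rightarrow> bool" where
  "collinear3 Z \<longleftrightarrow> (\<exists>u v w. (u, v, w) \<noteq> (0, 0, 0) \<and>
      (\<forall>P\<in>Z. u * fst P + v * fst (snd P) + w * snd (snd P) = 0))"

end

theory Submission
  imports Defs "Berlekamp_Zassenhaus.Unique_Factorization_Poly"
begin

text \<open>
  Let \<open>a = \<alpha>(I(Z))\<close> and suppose \<open>a \<ge> 2\<close>. A minimal subset \<open>Y\<close> of \<open>Z\<close> that lies on no curve of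
  degree \<open>a - 1\<close> has at least \<open>a (a + 1) / 2\<close> points, and the forms of degree \<open>a\<close> through \<open>Y\<close> have no
  common factor. Hence, for every irreducible form \<open>G\<close>, Bezout's inequality with such a form not
  divisible by \<open>G\<close> shows that the multiplicities of \<open>G\<close> at the points of \<open>Y\<close> add up to at most
  \<open>a deg G\<close>, and this bound passes to products. For a form of degree \<open>a + k - 1\<close> in \<open>I(kZ)\<close> it gives
  \<open>k a (a + 1) / 2 \<le> a (a + k - 1)\<close>, that is \<open>(k - 2) (a - 1) \<le> 0\<close>. (This is Chudnovsky's bound
  \<open>\<alpha>(I(kZ)) / k \<ge> (\<alpha>(I(Z)) + 1) / 2\<close>.)

  Bezout's inequality for a prime form \<open>G\<close> of degree \<open>g\<close> and a form \<open>C\<close> of degree \<open>a\<close> is a dimension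
  count in a large degree \<open>n\<close>: the products of \<open>G\<close> with all monomials, the products of \<open>C\<close> with the
  monomials that are not divisible by the leading monomial of \<open>G\<close>, and, for each point \<open>P\<close>, as
  many forms as the multiplicity of \<open>G\<close> at \<open>P\<close> are linearly independent. The latter are
  \<open>l ^ j U\<close>, where \<open>l\<close> is a linear form through \<open>P\<close> that is nonzero on a tangent direction of \<open>C\<close>,
  and \<open>U\<close> vanishes to high order at all other points.
\<close>

section \<open>Substitution\<close>

text \<open>Evaluation at a point, restriction to lines and pencils, and the passage to univariate
  polynomials are all instances of this map, so the homomorphism laws are proved once, for any
  coefficient homomorphism \<open>\<phi>\<close>.\<close>

definition subst3 :: "('a::comm_ring_1 \<Rightarrow> 'b::comm_ring_1) \<Rightarrow> 'b \<times> 'b \<times> 'b \<Rightarrow> 'a poly3 \<Rightarrow> 'b" where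
  "subst3 \<phi> p f = (\<Sum>m\<in>Poly_Mapping.keys f. \<phi> (Poly_Mapping.lookup f m) *
      (fst p ^ fst m * fst (snd p) ^ fst (snd m) * snd (snd p) ^ snd (snd m)))"

lemma eval3_eq_subst3: "eval3 f P = subst3 id P f"
  by (simp add: eval3_def subst3_def mult.assoc)

lemma poly_mapping_sum_single:
  "f = (\<Sum>m\<in>Poly_Mapping.keys f. Poly_Mapping.single m (Poly_Mapping.lookup f m))"
  by (rule poly_mapping_eqI)
    (auto simp: lookup_sum lookup_single when_def in_keys_iff sum.delta' sum.delta)

context
  fixes \<phi> :: "'a::comm_ring_1 \<Rightarrow> 'b::comm_ring_1"
  assumes hom: "comm_ring_hom \<phi>"
begin

interpretation comm_ring_hom \<phi> by (fact hom)

lemma subst3_superset: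
  assumes "finite A" "Poly_Mapping.keys f \<subseteq> A"
  shows "subst3 \<phi> p f = (\<Sum>m\<in>A. \<phi> (Poly_Mapping.lookup f m) *
      (fst p ^ fst m * fst (snd p) ^ fst (snd m) * snd (snd p) ^ snd (snd m)))"
  unfolding subst3_def using assms
  by (intro sum.mono_neutral_left) (auto simp: in_keys_iff)

lemma subst3_single:
  "subst3 \<phi> p (Poly_Mapping.single m c) =
     \<phi> c * (fst p ^ fst m * fst (snd p) ^ fst (snd m) * snd (snd p) ^ snd (snd m))"
  by (subst subst3_superset[of "{m}"]) auto

lemma subst3_zero: "subst3 \<phi> p 0 = 0"
  by (simp add: subst3_def)

lemma subst3_one: "subst3 \<phi> p 1 = 1"
proof -
  have "subst3 \<phi> p (Poly_Mapping.single 0 1) = 1"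
    by (simp add: subst3_single del: single_one)
  then show ?thesis by simp
qed

lemma subst3_add: "subst3 \<phi> p (f + g) = subst3 \<phi> p f + subst3 \<phi> p g"
proof -
  define A where "A = Poly_Mapping.keys f \<union> Poly_Mapping.keys g"
  have "finite A" "Poly_Mapping.keys f \<subseteq> A" "Poly_Mapping.keys g \<subseteq> A"
    "Poly_Mapping.keys (f + g) \<subseteq> A"
    using keys_add[of f g] by (auto simp: A_def)
  then show ?thesis
    by (simp add: subst3_superset[of A] lookup_add hom_add sum.distrib distrib_right)
qed

lemma subst3_sum: "subst3 \<phi> p (sum f A) = (\<Sum>i\<in>A. subst3 \<phi> p (f i))"
  by (induction A rule: infinite_finite_induct) (auto simp: subst3_zero subst3_add)

lemma subst3_mult: "subst3 \<phi> p (f * g) = subst3 \<phi> p f * subst3 \<phi> p g"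
proof -
  let ?s = "\<lambda>f m. Poly_Mapping.single m (Poly_Mapping.lookup f m)"
  have "f * g = (\<Sum>m\<in>Poly_Mapping.keys f. \<Sum>n\<in>Poly_Mapping.keys g. ?s f m * ?s g n)"
    by (simp only: sum_product[symmetric] poly_mapping_sum_single[symmetric])
  also have "subst3 \<phi> p \<dots> =
      (\<Sum>m\<in>Poly_Mapping.keys f. \<Sum>n\<in>Poly_Mapping.keys g. subst3 \<phi> p (?s f m) * subst3 \<phi> p (?s g n))"
    by (simp add: subst3_sum mult_single subst3_single hom_mult power_add algebra_simps)
  also have "\<dots> = subst3 \<phi> p (\<Sum>m\<in>Poly_Mapping.keys f. ?s f m) *
      subst3 \<phi> p (\<Sum>n\<in>Poly_Mapping.keys g. ?s g n)"
    by (simp add: subst3_sum sum_product)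
  finally show ?thesis
    by (simp only: poly_mapping_sum_single[symmetric])
qed

lemma subst3_hom: "comm_ring_hom (subst3 \<phi> p)"
  by unfold_locales (auto simp: subst3_zero subst3_one subst3_add subst3_mult)

end

lemma subst3_comp:
  assumes "comm_ring_hom \<psi>"
  shows "\<psi> (subst3 \<phi> p f) = subst3 (\<lambda>c. \<psi> (\<phi> c)) (\<psi> (fst p), \<psi> (fst (snd p)), \<psi> (snd (snd p))) f"
proof -
  interpret comm_ring_hom \<psi> by fact
  show ?thesis by (simp add: subst3_def hom_sum hom_mult hom_power)
qed

lemma comm_ring_hom_id: "comm_ring_hom id"
  by unfold_locales auto

lemma comm_ring_hom_comp:
  assumes "comm_ring_hom f" "comm_ring_hom g"
  shows "comm_ring_hom (\<lambda>x. f (g x))"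
proof -
  interpret f: comm_ring_hom f by fact
  interpret g: comm_ring_hom g by fact
  show ?thesis by unfold_locales (auto simp: f.hom_add g.hom_add f.hom_mult g.hom_mult)
qed

lemma comm_ring_hom_pCons: "comm_ring_hom (\<lambda>c::'a::comm_ring_1. [:c:])"
  by unfold_locales auto

lemma comm_ring_hom_const2: "comm_ring_hom (\<lambda>c::'a::comm_ring_1. [:[:c:]:])"
  by (rule comm_ring_hom_comp[OF comm_ring_hom_pCons comm_ring_hom_pCons])

lemma comm_ring_hom_const3: "comm_ring_hom (\<lambda>c::'a::comm_ring_1. [:[:[:c:]:]:])"
  by (rule comm_ring_hom_comp[OF comm_ring_hom_pCons comm_ring_hom_const2])

lemma comm_ring_hom_map_poly:
  assumes "comm_ring_hom \<psi>"
  shows "comm_ring_hom (map_poly \<psi>)"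
proof -
  interpret comm_ring_hom \<psi> by fact
  show ?thesis
    by unfold_locales (auto intro!: poly_eqI simp: coeff_map_poly coeff_mult hom_sum hom_add hom_mult)
qed

section \<open>The isomorphism with iterated univariate polynomials\<close>

text \<open>The isomorphism onto iterated univariate polynomials, with x0 innermost and x2
  outermost. It carries leading coefficients, absence of zero divisors and unique factorization over
  to \<open>poly3\<close>.\<close>

definition nest :: "'a::comm_ring_1 poly3 \<Rightarrow> 'a poly poly poly" where
  "nest = subst3 (\<lambda>c. [:[:[:c:]:]:]) ([:[:[:0, 1:]:]:], [:[:0, 1:]:], [:0, 1:])"

lemma comm_ring_hom_nest: "comm_ring_hom nest"
  unfolding nest_def by (rule subst3_hom) (rule comm_ring_hom_const3)

interpretation nest: comm_ring_hom nest
  by (rule comm_ring_hom_nest)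

lemma const_poly_power: "[:c:] ^ n = [:c ^ n:]" for c :: "'a::comm_semiring_1"
  by (induction n) (auto simp: mult.commute)

lemma nest_single: "nest (Poly_Mapping.single (i, j, l) c) = monom (monom (monom c i) j) l"
  unfolding nest_def subst3_single[OF comm_ring_hom_const3]
  by (simp add: const_poly_power monom_altdef)

lemma coeff_nest: "coeff (coeff (coeff (nest f) l) j) i = Poly_Mapping.lookup f (i, j, l)"
proof -
  have "nest f = (\<Sum>m\<in>Poly_Mapping.keys f. nest (Poly_Mapping.single m (Poly_Mapping.lookup f m)))"
    using arg_cong[OF poly_mapping_sum_single[of f], of nest] by (simp only: nest.hom_sum)
  also have "\<dots> = (\<Sum>m\<in>Poly_Mapping.keys f. case m of (i, j, l) \<Rightarrow>
      monom (monom (monom (Poly_Mapping.lookup f m) i) j) l)"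
    by (intro sum.cong) (auto simp: nest_single)
  also have "coeff (coeff (coeff \<dots> l) j) i =
      (\<Sum>m\<in>Poly_Mapping.keys f. if m = (i, j, l) then Poly_Mapping.lookup f (i, j, l) else 0)"
    unfolding coeff_sum by (intro sum.cong) (auto split: prod.splits)
  also have "\<dots> = Poly_Mapping.lookup f (i, j, l)"
    by (simp add: in_keys_iff)
  finally show ?thesis .
qed

lemma nest_eq_iff: "nest f = nest g \<longleftrightarrow> f = g"
proof
  assume "nest f = nest g"
  then show "f = g"
    by (intro poly_mapping_eqI) (metis coeff_nest prod_cases3)
qed simp

lemma nest_eq_0_iff: "nest f = 0 \<longleftrightarrow> f = 0"
  using nest_eq_iff[of f 0] by simp

text \<open>The image contains the constants and the three variables and is closed under sums and
  products, so one induction per level of nesting reaches everything.\<close>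

lemma nest_surj: "\<exists>f. nest f = p"
proof -
  have sum: "\<exists>f. nest f = u + v" if "\<exists>f. nest f = u" "\<exists>f. nest f = v" for u v :: "'a poly poly poly"
    using that by (metis nest.hom_add)
  have mult: "\<exists>f. nest f = u * v" if "\<exists>f. nest f = u" "\<exists>f. nest f = v" for u v :: "'a poly poly poly"
    using that by (metis nest.hom_mult)
  have X: "\<exists>f. nest f = ([:[:[:0, 1:]:]:] :: 'a poly poly poly)"
    "\<exists>f. nest f = ([:[:0, 1:]:] :: 'a poly poly poly)"
    "\<exists>f. nest f = ([:0, 1:] :: 'a poly poly poly)"
    using nest_single[of 1 0 0 "1::'a"] nest_single[of 0 1 0 "1::'a"] nest_single[of 0 0 1 "1::'a"]
    by (auto simp: monom_altdef)
  have c: "\<exists>f. nest f = [:[:[:c:]:]:]" for c :: 'a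
    using nest_single[of 0 0 0 c] by (auto simp: monom_0)
  have 1: "\<exists>f. nest f = [:[:q:]:]" for q :: "'a poly"
  proof (induction q)
    case (pCons a q)
    have "[:[:pCons a q:]:] = [:[:[:a:]:]:] + [:[:[:0, 1:]:]:] * [:[:q:]:]"
      by simp
    then show ?case using sum[OF c mult[OF X(1) pCons(2)]] by metis
  qed (rule exI[of _ 0], simp)
  have 2: "\<exists>f. nest f = [:q:]" for q :: "'a poly poly"
  proof (induction q)
    case (pCons a q)
    have "[:pCons a q:] = [:[:a:]:] + [:[:0, 1:]:] * [:q:]"
      by simp
    then show ?case using sum[OF 1 mult[OF X(2) pCons(2)]] by metis
  qed (rule exI[of _ 0], simp)
  show ?thesis
  proof (induction p)
    case (pCons a q)
    have "pCons a q = [:a:] + [:0, 1:] * q"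
      by simp
    then show ?case using sum[OF 2 mult[OF X(3) pCons(2)]] by metis
  qed (rule exI[of _ 0], simp)
qed

lemma nest_dvd_iff: "nest f dvd nest g \<longleftrightarrow> f dvd g"
proof
  assume "nest f dvd nest g"
  then obtain h where "nest g = nest f * h" by (auto elim: dvdE)
  moreover obtain k where "h = nest k" using nest_surj by metis
  ultimately have "nest g = nest (f * k)" by (simp add: nest.hom_mult)
  then show "f dvd g" by (simp add: nest_eq_iff)
next
  assume "f dvd g"
  then obtain h where "g = f * h" ..
  then show "nest f dvd nest g" by (simp add: nest.hom_mult)
qed

lemma poly3_mult_eq_0_iff:
  fixes f g :: "'a::idom poly3"
  shows "f * g = 0 \<longleftrightarrow> f = 0 \<or> g = 0"
proof -
  have "f * g = 0 \<longleftrightarrow> nest f * nest g = 0"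
    by (simp only: nest_eq_0_iff[symmetric] nest.hom_mult)
  then show ?thesis by (simp add: nest_eq_0_iff)
qed

text \<open>The leading monomial for the lexicographic order with \<open>x2 > x1 > x0\<close>.\<close>
definition lm :: "'a::comm_ring_1 poly3 \<Rightarrow> mono3" where
  "lm f = (degree (lead_coeff (lead_coeff (nest f))), degree (lead_coeff (nest f)), degree (nest f))"

lemma lm_in_keys: "f \<noteq> 0 \<Longrightarrow> lm f \<in> Poly_Mapping.keys f"
  unfolding lm_def in_keys_iff coeff_nest[symmetric] by (simp add: nest_eq_0_iff)

lemma lm_mult:
  fixes f g :: "'a::idom poly3"
  assumes "f \<noteq> 0" "g \<noteq> 0"
  shows "lm (f * g) = lm f + lm g"
  using assms unfolding lm_def nest.hom_mult lead_coeff_mult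
  by (simp add: degree_mult_eq nest_eq_0_iff)

section \<open>Forms\<close>

lemma mdeg_add: "mdeg (m + n) = mdeg m + mdeg n"
  by (simp add: mdeg_def)

lemma mdeg_zero: "mdeg 0 = 0"
  by (simp add: mdeg_def)

lemma homogeneous_zero: "homogeneous n 0"
  by (simp add: homogeneous_def)

lemma homogeneous_single: "mdeg m = n \<Longrightarrow> homogeneous n (Poly_Mapping.single m c)"
  by (simp add: homogeneous_def)

lemma homogeneous_add: "homogeneous n f \<Longrightarrow> homogeneous n g \<Longrightarrow> homogeneous n (f + g)"
  using keys_add[of f g] by (auto simp: homogeneous_def)

lemma homogeneous_diff:
  "homogeneous n f \<Longrightarrow> homogeneous n g \<Longrightarrow> homogeneous n (f - g)" for f :: "'a::comm_ring_1 poly3"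
  using keys_diff[of f g] by (auto simp: homogeneous_def)

lemma homogeneous_sum: "(\<And>i. i \<in> A \<Longrightarrow> homogeneous n (f i)) \<Longrightarrow> homogeneous n (sum f A)"
  by (induction A rule: infinite_finite_induct) (auto intro: homogeneous_add homogeneous_zero)

lemma homogeneous_mult:
  "homogeneous n f \<Longrightarrow> homogeneous k g \<Longrightarrow> homogeneous (n + k) (f * g)"
  unfolding homogeneous_def
proof
  fix m assume *: "\<forall>m\<in>Poly_Mapping.keys f. mdeg m = n" "\<forall>m\<in>Poly_Mapping.keys g. mdeg m = k"
    "m \<in> Poly_Mapping.keys (f * g)"
  then obtain a b where "m = a + b" "a \<in> Poly_Mapping.keys f" "b \<in> Poly_Mapping.keys g"
    using keys_mult[of f g] by blast
  then show "mdeg m = n + k" using * by (simp add: mdeg_add)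
qed

lemma homogeneous_one: "homogeneous 0 (1 :: 'a::comm_ring_1 poly3)"
  using homogeneous_single[OF mdeg_zero, of "1 :: 'a"] by simp

lemma homogeneous_power: "homogeneous n f \<Longrightarrow> homogeneous (k * n) (f ^ k)" for f :: "'a::comm_ring_1 poly3"
  by (induction k) (auto intro: homogeneous_mult homogeneous_one)

lemma homogeneous_const_mult: "homogeneous n f \<Longrightarrow> homogeneous n (Poly_Mapping.single 0 c * f)"
  using homogeneous_mult[OF homogeneous_single[OF mdeg_zero], of n f c] by simp

lemma lookup_const_mult: "Poly_Mapping.lookup (Poly_Mapping.single 0 c * f) m = c * Poly_Mapping.lookup f m"
  for f :: "'a::comm_ring_1 poly3"
  by (simp add: mult_map_scale_conv_mult[symmetric] map.rep_eq when_def)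

lemma homogeneous_mdeg_lm: "homogeneous n f \<Longrightarrow> f \<noteq> 0 \<Longrightarrow> mdeg (lm f) = n"
  using lm_in_keys by (auto simp: homogeneous_def)

lemma homogeneous_0_const:
  assumes "homogeneous 0 f"
  shows "f = Poly_Mapping.single 0 (Poly_Mapping.lookup f 0)"
proof (rule poly_mapping_eqI)
  fix m :: mono3
  show "Poly_Mapping.lookup f m = Poly_Mapping.lookup (Poly_Mapping.single 0 (Poly_Mapping.lookup f 0)) m"
  proof (cases "m = 0")
    case False
    then have "mdeg m \<noteq> 0" by (cases m) (auto simp: mdeg_def zero_prod_def)
    then have "m \<notin> Poly_Mapping.keys f" using assms by (auto simp: homogeneous_def)
    then show ?thesis using False by (simp add: in_keys_iff lookup_single when_def)
  qed simp
qed

lemma lookup_hcomp: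
  "Poly_Mapping.lookup (hcomp d f) m = (if mdeg m = d then Poly_Mapping.lookup f m else 0)"
proof -
  have "finite {m. (if mdeg m = d then Poly_Mapping.lookup f m else 0) \<noteq> 0}"
    by (rule finite_subset[OF _ finite_keys[of f]]) (auto simp: in_keys_iff)
  then show ?thesis by (simp add: hcomp_def)
qed

section \<open>Counting monomials\<close>

lemma monomials_finite: "finite {m. mdeg m = n}"
  by (rule finite_subset[of _ "{..n} \<times> {..n} \<times> {..n}"]) (auto simp: mdeg_def)

lemma card_monomials: "2 * card {m. mdeg m = n} = (n + 1) * (n + 2)"
proof -
  have "{m. mdeg m = n} = (\<lambda>(i, j). (i, j, n - i - j)) ` (SIGMA i:{..n}. {..n - i})"
  proof (intro equalityI subsetI)
    fix m assume "m \<in> {m. mdeg m = n}"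
    then have "m = (\<lambda>(i, j). (i, j, n - i - j)) (fst m, fst (snd m))"
      "(fst m, fst (snd m)) \<in> (SIGMA i:{..n}. {..n - i})"
      by (cases m, auto simp: mdeg_def)+
    then show "m \<in> (\<lambda>(i, j). (i, j, n - i - j)) ` (SIGMA i:{..n}. {..n - i})"
      by (rule image_eqI)
  qed (auto simp: mdeg_def)
  moreover have "inj_on (\<lambda>(i, j). (i, j, n - i - j)) (SIGMA i:{..n}. {..n - i})"
    by (auto simp: inj_on_def)
  ultimately have "card {m. mdeg m = n} = (\<Sum>i\<le>n. Suc (n - i))"
    by (simp add: card_image)
  also have "\<dots> = (\<Sum>i\<le>n. Suc i)"
    by (rule sum.reindex_bij_witness[of _ "\<lambda>i. n - i" "\<lambda>i. n - i"]) auto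
  also have "2 * \<dots> = (n + 1) * (n + 2)"
    by (induction n) auto
  finally show ?thesis .
qed

text \<open>Translation by \<open>\<mu>\<close> maps the monomials of degree \<open>n\<close>
  bijectively onto the multiples of \<open>\<mu>\<close> in degree \<open>n + g\<close>.\<close>

lemma card_monomials_not_multiple:
  assumes "mdeg \<mu> = g"
  shows "card {m. mdeg m = n + g \<and> (\<nexists>k. m = \<mu> + k)} + card {m. mdeg m = n} = card {m. mdeg m = n + g}"
proof -
  have "(+) \<mu> ` {m. mdeg m = n} = {m. mdeg m = n + g \<and> (\<exists>k. m = \<mu> + k)}"
    using assms by (auto simp: mdeg_add)
  then have "card {m. mdeg m = n} = card {m. mdeg m = n + g \<and> (\<exists>k. m = \<mu> + k)}"
    using card_image[of "(+) \<mu>" "{m. mdeg m = n}"] by simp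
  moreover have "card {m. mdeg m = n + g} = card {m. mdeg m = n + g \<and> (\<nexists>k. m = \<mu> + k)} +
      card {m. mdeg m = n + g \<and> (\<exists>k. m = \<mu> + k)}"
    by (subst card_Un_disjoint[symmetric])
      (auto intro!: arg_cong[of _ _ card] finite_subset[OF _ monomials_finite[of "n + g"]])
  ultimately show ?thesis by simp
qed

section \<open>Homogeneous components and factors of forms\<close>

text \<open>Each variable is multiplied by a new outermost variable t. The coefficient of t^d is
  then the component of degree d, and a form becomes a single monomial in t.\<close>

definition grade :: "'a::comm_ring_1 poly3 \<Rightarrow> 'a poly poly poly poly" where
  "grade = subst3 (\<lambda>c. [:[:[:[:c:]:]:]:])
     ([:0, [:[:[:0, 1:]:]:]:], [:0, [:[:0, 1:]:]:], [:0, [:0, 1:]:])"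

lemma comm_ring_hom_const4: "comm_ring_hom (\<lambda>c::'a::comm_ring_1. [:[:[:[:c:]:]:]:])"
  by (rule comm_ring_hom_comp[OF comm_ring_hom_pCons comm_ring_hom_const3])

interpretation grade: comm_ring_hom grade
  unfolding grade_def by (rule subst3_hom) (rule comm_ring_hom_const4)

lemma linear_power: "[:0, c:] ^ n = monom (c ^ n) n" for c :: "'a::comm_semiring_1"
  by (induction n) (auto simp: monom_Suc monom_0 smult_monom mult.commute)

lemma grade_single: "grade (Poly_Mapping.single m c) = monom (nest (Poly_Mapping.single m c)) (mdeg m)"
  unfolding grade_def nest_def subst3_single[OF comm_ring_hom_const4] subst3_single[OF comm_ring_hom_const3]
  by (simp add: linear_power mult_monom smult_monom mdeg_def)

lemma coeff_grade: "coeff (grade f) d = nest (hcomp d f)"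
proof -
  let ?s = "\<lambda>m. Poly_Mapping.single m (Poly_Mapping.lookup f m)"
  have "hcomp d f = (\<Sum>m\<in>Poly_Mapping.keys f. if mdeg m = d then ?s m else 0)"
  proof (rule poly_mapping_eqI)
    fix k
    have "Poly_Mapping.lookup (\<Sum>m\<in>Poly_Mapping.keys f. if mdeg m = d then ?s m else 0) k =
        (\<Sum>m\<in>Poly_Mapping.keys f. if k = m then Poly_Mapping.lookup (hcomp d f) k else 0)"
      unfolding lookup_sum by (intro sum.cong) (auto simp: lookup_single lookup_hcomp)
    also have "\<dots> = Poly_Mapping.lookup (hcomp d f) k"
      by (simp add: lookup_hcomp in_keys_iff)
    finally show "Poly_Mapping.lookup (hcomp d f) k =
        Poly_Mapping.lookup (\<Sum>m\<in>Poly_Mapping.keys f. if mdeg m = d then ?s m else 0) k" ..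
  qed
  moreover have "coeff (grade (\<Sum>m\<in>Poly_Mapping.keys f. ?s m)) d =
      (\<Sum>m\<in>Poly_Mapping.keys f. nest (if mdeg m = d then ?s m else 0))"
    unfolding grade.hom_sum coeff_sum by (intro sum.cong) (auto simp: grade_single)
  ultimately show ?thesis
    by (simp only: poly_mapping_sum_single[symmetric] nest.hom_sum)
qed

lemma hcomp_homogeneous: "homogeneous n f \<Longrightarrow> hcomp d f = (if d = n then f else 0)"
  by (rule poly_mapping_eqI) (auto simp: lookup_hcomp homogeneous_def in_keys_iff)

text \<open>The order at 0 never exceeds the degree, both are additive on products, and they agree
  on \<open>monom c n\<close>. Hence they agree on each factor.\<close>

lemma monom_factor:
  fixes p q :: "'a::idom poly"
  assumes "p * q = monom c n" "c \<noteq> 0"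
  shows "p = monom (lead_coeff p) (degree p)"
proof -
  have nz: "p * q \<noteq> 0" "p \<noteq> 0" "q \<noteq> 0" using assms by (auto simp: monom_eq_0_iff)
  have "Polynomial.order 0 p + Polynomial.order 0 q = n"
    using order_mult[OF nz(1), of 0] assms by (simp add: order_0_monom)
  moreover have "degree p + degree q = n"
    using degree_mult_eq[OF nz(2,3)] assms by (simp add: degree_monom_eq)
  moreover have "Polynomial.order 0 p \<le> degree p" "Polynomial.order 0 q \<le> degree q"
    using nz by (auto intro: order_degree)
  ultimately have "Polynomial.order 0 p = degree p" by simp
  then have "monom 1 (degree p) dvd p"
    using order_1[of 0 p] by (simp add: monom_altdef)
  then have "\<forall>k<degree p. coeff p k = 0"
    by (simp add: monom_1_dvd_iff')
  then show ?thesis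
    by (intro poly_eqI) (metis coeff_monom le_degree linorder_neqE_nat not_le)
qed

text \<open>The factors of the monomial \<open>grade (A * B)\<close> are monomials by
  \<open>monom_factor\<close>, which is homogeneity; degrees are compared on leading
  monomials.\<close>

lemma homogeneous_factors:
  fixes A B :: "'a::idom poly3"
  assumes "homogeneous g (A * B)" "A * B \<noteq> 0"
  shows "\<exists>i j. homogeneous i A \<and> homogeneous j B \<and> i + j = g"
proof -
  have fac: "\<exists>i. homogeneous i A" if "homogeneous g (A * B)" "A * B \<noteq> 0" for A B :: "'a poly3"
  proof -
    have "grade A * grade B = monom (nest (A * B)) g"
      using that(1) by (intro poly_eqI) (simp add: coeff_grade hcomp_homogeneous flip: grade.hom_mult)
    then have "grade A = monom (lead_coeff (grade A)) (degree (grade A))"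
      using that(2) by (intro monom_factor) (auto simp: nest_eq_0_iff)
    then have *: "coeff (grade A) d = 0" if "d \<noteq> degree (grade A)" for d
      using that by (metis coeff_monom)
    have "homogeneous (degree (grade A)) A"
      unfolding homogeneous_def
    proof (intro ballI, rule ccontr)
      fix m assume m: "m \<in> Poly_Mapping.keys A" "mdeg m \<noteq> degree (grade A)"
      then have "hcomp (mdeg m) A = 0"
        using * by (simp add: coeff_grade nest_eq_0_iff)
      then show False
        using m(1) lookup_hcomp[of "mdeg m" A m] by (simp add: in_keys_iff)
    qed
    then show ?thesis ..
  qed
  obtain i where i: "homogeneous i A" using fac assms by blast
  obtain j where j: "homogeneous j B" using fac[of B A] assms by (auto simp: mult.commute)
  have "A \<noteq> 0" "B \<noteq> 0" using assms by auto
  then have "i + j = g"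
    using homogeneous_mdeg_lm[OF i] homogeneous_mdeg_lm[OF j] homogeneous_mdeg_lm[OF assms]
    by (simp add: lm_mult mdeg_add)
  then show ?thesis using i j by blast
qed

text \<open>All factors of a form are forms, so irreducibility among forms is irreducibility in the
  whole ring. Over a field that ring is factorial, and its irreducible elements are prime.\<close>

lemma homogeneous_irreducible_prime:
  fixes G :: "'a::field poly3"
  assumes G: "G \<noteq> 0" "homogeneous g G" "g > 0"
    and irr: "\<And>A B i j. G = A * B \<Longrightarrow> homogeneous i A \<Longrightarrow> homogeneous j B \<Longrightarrow> i = 0 \<or> j = 0"
    and dvd: "G dvd A * B"
  shows "G dvd A \<or> G dvd B"
proof -
  have unit: "nest f dvd 1" if "homogeneous 0 f" "f \<noteq> 0" for f :: "'a poly3"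
  proof -
    define c where "c = Poly_Mapping.lookup f 0"
    have f: "f = Poly_Mapping.single 0 c"
      unfolding c_def by (rule homogeneous_0_const[OF that(1)])
    then have "f * Poly_Mapping.single 0 (inverse c) = 1"
      using that(2) by (cases "c = 0") (auto simp: mult_single)
    then have "f dvd 1" by (metis dvd_triv_left)
    then show ?thesis using nest_dvd_iff[of f 1] by simp
  qed
  have "irreducible (nest G)"
  proof (rule irreducibleI)
    show "nest G \<noteq> 0" using G by (simp add: nest_eq_0_iff)
    show "\<not> nest G dvd 1"
    proof
      assume "nest G dvd 1"
      then have "G dvd 1" using nest_dvd_iff[of G 1] by simp
      then obtain H where H: "1 = G * H" ..
      then have "H \<noteq> 0" by auto
      then have "lm (1 :: 'a poly3) = lm G + lm H" using G by (simp add: H lm_mult)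
      then show False
        using homogeneous_mdeg_lm[OF G(2,1)] homogeneous_mdeg_lm[OF homogeneous_one[where 'a = 'a]] G(3)
        by (simp add: mdeg_add)
    qed
  next
    fix a b assume ab: "nest G = a * b"
    obtain A B where AB: "a = nest A" "b = nest B" using nest_surj by metis
    then have "G = A * B" using ab by (simp add: nest_eq_iff flip: nest.hom_mult)
    moreover from this obtain i j where "homogeneous i A" "homogeneous j B"
      using homogeneous_factors G by metis
    moreover have "A \<noteq> 0" "B \<noteq> 0" using G calculation(1) by auto
    ultimately show "a dvd 1 \<or> b dvd 1"
      using irr unit AB by metis
  qed
  then have "prime_elem (nest G)" by simp
  moreover have "nest G dvd nest A * nest B" using dvd by (simp add: nest_dvd_iff flip: nest.hom_mult)
  ultimately show ?thesis by (auto simp: prime_elem_dvd_mult_iff nest_dvd_iff)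
qed

section \<open>Homogeneous linear systems\<close>

text \<open>Gaussian elimination: an equation with a nonzero coefficient at \<open>p\<close>
  eliminates the unknown \<open>p\<close>, which lowers both counts by one.\<close>

lemma underdetermined_system:
  fixes A :: "'j \<Rightarrow> 'i \<Rightarrow> 'a::field"
  assumes "finite J" "finite I" "card J < card I"
  shows "\<exists>c. (\<exists>i\<in>I. c i \<noteq> 0) \<and> (\<forall>j\<in>J. (\<Sum>i\<in>I. A j i * c i) = 0)"
  using assms
proof (induction J arbitrary: I A rule: finite_induct)
  case empty
  then have "I \<noteq> {}" by auto
  then show ?case by (intro exI[of _ "\<lambda>_. 1"]) auto
next
  case (insert j J)
  show ?case
  proof (cases "\<forall>i\<in>I. A j i = 0")
    case True
    have "card J < card I" using insert by auto
    then show ?thesis using insert.IH[of I A] True insert.prems by auto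
  next
    case False
    then obtain p where p: "p \<in> I" "A j p \<noteq> 0" by auto
    have "card J < card (I - {p})" using insert p by auto
    then obtain c where c: "\<exists>i\<in>I - {p}. c i \<noteq> 0"
      "\<forall>k\<in>J. (\<Sum>i\<in>I - {p}. (A k i - A k p * A j i / A j p) * c i) = 0"
      using insert.IH[of "I - {p}" "\<lambda>k i. A k i - A k p * A j i / A j p"] insert.prems by auto
    define s where "s = (\<Sum>i\<in>I - {p}. A j i * c i)"
    \<comment> \<open>The eliminated unknown is recovered from equation \<open>j\<close>.\<close>
    define d where "d = c(p := - s / A j p)"
    have sumd: "(\<Sum>i\<in>I. A k i * d i) = A k p * (- s / A j p) + (\<Sum>i\<in>I - {p}. A k i * c i)" for k
      using p insert.prems by (subst sum.remove[of I p]) (auto simp: d_def intro!: sum.cong)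
    have "(\<Sum>i\<in>I. A j i * d i) = 0"
      unfolding sumd using p by (simp add: s_def)
    moreover have "(\<Sum>i\<in>I. A k i * d i) = 0" if "k \<in> J" for k
    proof -
      have "(\<Sum>i\<in>I - {p}. (A k i - A k p * A j i / A j p) * c i) =
          (\<Sum>i\<in>I - {p}. A k i * c i) - A k p / A j p * s"
        by (simp add: s_def sum_subtractf sum_distrib_left algebra_simps)
      then show ?thesis using c(2) that by (simp add: sumd)
    qed
    moreover have "\<exists>i\<in>I. d i \<noteq> 0" using c(1) by (auto simp: d_def)
    ultimately show ?thesis by blast
  qed
qed

section \<open>Order of vanishing at a point\<close>

definition scale3 :: "'a::times \<Rightarrow> 'a \<times> 'a \<times> 'a \<Rightarrow> 'a \<times> 'a \<times> 'a" where
  "scale3 c P = (c * fst P, c * fst (snd P), c * snd (snd P))"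

definition dot3 :: "'a::semiring_0 \<times> 'a \<times> 'a \<Rightarrow> 'a \<times> 'a \<times> 'a \<Rightarrow> 'a" where
  "dot3 u P = fst u * fst P + fst (snd u) * fst (snd P) + snd (snd u) * snd (snd P)"

text \<open>\<open>line P Q f\<close> is the polynomial \<open>f(P + t Q)\<close> in \<open>t\<close>.\<close>
definition line :: "'a::comm_ring_1 \<times> 'a \<times> 'a \<Rightarrow> 'a \<times> 'a \<times> 'a \<Rightarrow> 'a poly3 \<Rightarrow> 'a poly" where
  "line P Q = subst3 (\<lambda>c. [:c:])
     ([:fst P, fst Q:], [:fst (snd P), fst (snd Q):], [:snd (snd P), snd (snd Q):])"

interpretation line: comm_ring_hom "line P Q"
  unfolding line_def by (rule subst3_hom) (rule comm_ring_hom_pCons)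

text \<open>\<open>pencil P Q R f\<close> is \<open>f(P + t (Q + s R))\<close>, a polynomial in \<open>t\<close> over the polynomials in \<open>s\<close>.\<close>
definition pencil :: "'a::comm_ring_1 \<times> 'a \<times> 'a \<Rightarrow> 'a \<times> 'a \<times> 'a \<Rightarrow> 'a \<times> 'a \<times> 'a \<Rightarrow>
    'a poly3 \<Rightarrow> 'a poly poly" where
  "pencil P Q R = subst3 (\<lambda>c. [:[:c:]:])
     ([:[:fst P:], [:fst Q, fst R:]:], [:[:fst (snd P):], [:fst (snd Q), fst (snd R):]:],
      [:[:snd (snd P):], [:snd (snd Q), snd (snd R):]:])"

interpretation pencil: comm_ring_hom "pencil P Q R"
  unfolding pencil_def by (rule subst3_hom) (rule comm_ring_hom_const2)

lemma comm_ring_hom_poly: "comm_ring_hom (\<lambda>p. poly p s)"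
  by unfold_locales auto

text \<open>Vanishing on all lines of a pencil can thus be read as the vanishing of one polynomial
  in \<open>s\<close>.\<close>

lemma coeff_line_pencil:
  "coeff (line P (Q + scale3 s R) f) i = poly (coeff (pencil P Q R f) i) s"
proof -
  have const: "map_poly (\<lambda>p. poly p s) [:[:c:]:] = [:c:]"
    and linear: "map_poly (\<lambda>p. poly p s) [:[:a:], [:b, c:]:] = [:a, b + s * c:]" for a b c
    by (auto intro!: poly_eqI simp: coeff_map_poly coeff_pCons split: nat.splits)
  have "map_poly (\<lambda>p. poly p s) (pencil P Q R f) = line P (Q + scale3 s R) f"
    unfolding pencil_def line_def subst3_comp[OF comm_ring_hom_map_poly[OF comm_ring_hom_poly]]
    by (simp add: const linear scale3_def)
  then have "line P (Q + scale3 s R) f = map_poly (\<lambda>p. poly p s) (pencil P Q R f)" ..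
  then show ?thesis by (simp add: coeff_map_poly)
qed

lemma coeff_line_0: "coeff (line P Q f) 0 = eval3 f P"
proof -
  have "poly (line P Q f) 0 = eval3 f P"
    unfolding line_def eval3_eq_subst3 subst3_comp[OF comm_ring_hom_poly]
    by (simp add: id_def)
  then show ?thesis by (simp add: poly_0_coeff_0)
qed

lemma coeff_line_scale: "coeff (line P (scale3 u Q) f) i = u ^ i * coeff (line P Q f) i"
proof -
  have "comm_ring_hom (\<lambda>p. p \<circ>\<^sub>p [:0, u:])"
    by unfold_locales (auto simp: pcompose_add pcompose_mult pcompose_1)
  from subst3_comp[OF this, of "\<lambda>c. [:c:]" "([:fst P, fst Q:], [:fst (snd P), fst (snd Q):],
      [:snd (snd P), snd (snd Q):])" f]
  have "line P (scale3 u Q) f = line P Q f \<circ>\<^sub>p [:0, u:]"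
    by (simp add: line_def pcompose_pCons scale3_def mult.commute)
  then show ?thesis by (simp add: coeff_pcompose_linear)
qed

section \<open>Multiplicity at a point\<close>

text \<open>Multiplicity at least \<open>m\<close>, tested on all affine lines through the
  representative \<open>P\<close>. Over an infinite field this is the vanishing of all Taylor terms
  of order below \<open>m\<close> at \<open>P\<close>.\<close>

definition vanish :: "nat \<Rightarrow> 'a::comm_ring_1 \<times> 'a \<times> 'a \<Rightarrow> 'a poly3 \<Rightarrow> bool" where
  "vanish m P f \<longleftrightarrow> (\<forall>Q. \<forall>i<m. coeff (line P Q f) i = 0)"

lemma vanishD: "vanish m P f \<Longrightarrow> i < m \<Longrightarrow> coeff (line P Q f) i = 0"
  by (cases Q) (simp add: vanish_def)

lemma vanish_0: "vanish 0 P f"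
  by (simp add: vanish_def)

lemma vanish_1_iff: "vanish 1 P f \<longleftrightarrow> eval3 f P = 0"
  by (simp add: vanish_def coeff_line_0)

lemma vanish_mono: "vanish m P f \<Longrightarrow> n \<le> m \<Longrightarrow> vanish n P f"
  by (auto simp: vanish_def)

lemma vanish_zero: "vanish m P 0"
  by (simp add: vanish_def)

lemma vanish_add: "vanish m P f \<Longrightarrow> vanish m P g \<Longrightarrow> vanish m P (f + g)"
  by (simp add: vanish_def line.hom_add)

lemma vanish_uminus: "vanish m P f \<Longrightarrow> vanish m P (- f)"
  by (simp add: vanish_def line.hom_uminus)

lemma vanish_sum: "(\<And>i. i \<in> A \<Longrightarrow> vanish m P (f i)) \<Longrightarrow> vanish m P (sum f A)"
  by (induction A rule: infinite_finite_induct) (auto intro: vanish_add vanish_zero)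

lemma coeff_mult_low:
  fixes p q :: "'a::comm_semiring_1 poly"
  assumes "\<And>i. i < c \<Longrightarrow> coeff p i = 0" "\<And>i. i < e \<Longrightarrow> coeff q i = 0"
  shows "i < c + e \<Longrightarrow> coeff (p * q) i = 0"
    and "coeff (p * q) (c + e) = coeff p c * coeff q e"
proof -
  show "coeff (p * q) i = 0" if "i < c + e"
    unfolding coeff_mult
  proof (intro sum.neutral ballI)
    fix j assume "j \<in> {..i}"
    then have "j < c \<or> i - j < e" using that by auto
    then show "coeff p j * coeff q (i - j) = 0" using assms by auto
  qed
  have "coeff (p * q) (c + e) = (\<Sum>j\<in>{..c + e}. if j = c then coeff p c * coeff q e else 0)"
    unfolding coeff_mult
  proof (intro sum.cong refl)
    fix j assume "j \<in> {..c + e}"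
    then have "j = c \<or> j < c \<or> c + e - j < e" by auto
    then show "coeff p j * coeff q (c + e - j) = (if j = c then coeff p c * coeff q e else 0)"
      using assms by auto
  qed
  then show "coeff (p * q) (c + e) = coeff p c * coeff q e" by simp
qed

lemma vanish_mult: "vanish m P f \<Longrightarrow> vanish n P g \<Longrightarrow> vanish (m + n) P (f * g)"
  unfolding vanish_def[of "m + n"] line.hom_mult
  by (intro allI impI coeff_mult_low(1)[of m _ n]) (auto intro: vanishD)

lemma vanish_mult_left: "vanish m P f \<Longrightarrow> vanish m P (g * f)"
  using vanish_mult[OF vanish_0, of m P f g] by simp

lemma vanish_mult_right: "vanish m P f \<Longrightarrow> vanish m P (f * g)"
  using vanish_mult[OF _ vanish_0, of m P f g] by simp

lemma vanish_power: "vanish m P f \<Longrightarrow> vanish (k * m) P (f ^ k)"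
  by (induction k) (auto intro: vanish_mult vanish_0)

lemma vanish_order_below:
  assumes "\<not> vanish m P f"
  obtains c where "c < m" "vanish c P f" "\<not> vanish (Suc c) P f"
proof -
  define n where "n = (LEAST n. \<not> vanish n P f)"
  have n: "\<not> vanish n P f" "\<And>k. k < n \<Longrightarrow> vanish k P f" "n \<le> m"
    unfolding n_def using LeastI[of "\<lambda>n. \<not> vanish n P f"] assms
    by (auto dest: not_less_Least intro: Least_le)
  then have "n \<noteq> 0" using vanish_0 by metis
  then obtain c where "n = Suc c" using not0_implies_Suc by blast
  then show ?thesis using n that[of c] by simp
qed

text \<open>The lowest coefficients of the two factors, restricted to a pencil of lines through \<open>P\<close>
  that contains a good direction for each of them, are nonzero polynomials in the parameter.\<close>
lemma vanish_factor:
  fixes f g :: "'a::field_char_0 poly3"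
  assumes fg: "vanish m P (f * g)" and f: "\<not> vanish (Suc c) P f"
  shows "vanish (m - c) P g"
proof (rule ccontr)
  assume "\<not> vanish (m - c) P g"
  then obtain e where e: "e < m - c" "vanish e P g" "\<not> vanish (Suc e) P g"
    by (rule vanish_order_below)
  obtain d where d: "d < Suc c" "vanish d P f" "\<not> vanish (Suc d) P f"
    by (rule vanish_order_below[OF f])
  obtain Q1 where Q1: "coeff (line P Q1 f) d \<noteq> 0"
    using d(2,3) by (auto simp: vanish_def less_Suc_eq)
  obtain Q2 where Q2: "coeff (line P Q2 g) e \<noteq> 0"
    using e(2,3) by (auto simp: vanish_def less_Suc_eq)
  let ?h = "pencil P Q1 (Q2 - Q1)"
  \<comment> \<open>A polynomial in \<open>s\<close> that is zero at every \<open>s\<close> is zero,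
    because the field is infinite.\<close>
  have zero: "coeff (?h k) i = 0" if "vanish n P k" "i < n" for k i n
    unfolding poly_all_0_iff_0[symmetric] coeff_line_pencil[symmetric]
    using vanishD[OF that] by blast
  have ends: "Q1 = Q1 + scale3 0 (Q2 - Q1)" "Q2 = Q1 + scale3 1 (Q2 - Q1)"
    by (simp_all add: scale3_def prod_eq_iff)
  have "coeff (?h f) d \<noteq> 0"
    using Q1 coeff_line_pencil[of P Q1 0 "Q2 - Q1" f d] ends by auto
  moreover have "coeff (?h g) e \<noteq> 0"
    using Q2 coeff_line_pencil[of P Q1 1 "Q2 - Q1" g e] ends by auto
  moreover have "coeff (?h (f * g)) (d + e) = coeff (?h f) d * coeff (?h g) e"
    unfolding pencil.hom_mult using d(2) e(2) zero by (intro coeff_mult_low(2)) auto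
  moreover have "coeff (?h (f * g)) (d + e) = 0"
    using d(1) e(1) by (intro zero[OF fg]) auto
  ultimately show False by simp
qed

text \<open>Additivity of multiplicity: \<open>k\<close> is the order of \<open>f\<close>, capped at
  \<open>m\<close>, and \<open>g\<close> must supply the rest. This distributes the multiplicities
  of a reducible form over its factors.\<close>

lemma vanish_mult_split:
  fixes f g :: "'a::field_char_0 poly3"
  assumes "vanish m P (f * g)"
  shows "\<exists>k l. k + l = m \<and> vanish k P f \<and> vanish l P g"
proof (cases "vanish m P f")
  case True
  then show ?thesis using vanish_0 by (metis add_0_right)
next
  case False
  then obtain c where c: "c < m" "vanish c P f" "\<not> vanish (Suc c) P f"
    by (rule vanish_order_below)
  then show ?thesis using vanish_factor[OF assms c(3)]
    by (intro exI[of _ c] exI[of _ "m - c"]) auto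
qed

section \<open>From powers of point ideals to multiplicities\<close>

lemma ideal_pt_eval3:
  assumes "f \<in> ideal_pt P"
  shows "eval3 f P = 0"
proof -
  interpret ev: comm_ring_hom "subst3 id P" by (rule subst3_hom) (rule comm_ring_hom_id)
  define D where "D = mdeg ` Poly_Mapping.keys f"
  have "f = (\<Sum>d\<in>D. hcomp d f)"
    by (rule poly_mapping_eqI) (auto simp: lookup_sum lookup_hcomp D_def in_keys_iff)
  then have "eval3 f P = (\<Sum>d\<in>D. eval3 (hcomp d f) P)"
    unfolding eval3_eq_subst3 using ev.hom_sum by metis
  then show ?thesis using assms by (simp add: ideal_pt_def)
qed

text \<open>Every factor taken from \<open>ideal_pt P\<close> contributes one order of vanishing,
  and sums and multiples preserve the order reached.\<close>

lemma ideal_pow_vanish: "f \<in> ideal_pow (ideal_pt P) k \<Longrightarrow> vanish k P f"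
proof (induction k arbitrary: f)
  case (Suc k)
  then have "f \<in> gen_ideal {a * b |a b. a \<in> ideal_pt P \<and> b \<in> ideal_pow (ideal_pt P) k}"
    by (simp add: ideal_prod_def)
  then show ?case
  proof (induction f rule: gen_ideal.induct)
    case (mult s r)
    then obtain a b where ab: "s = a * b" "a \<in> ideal_pt P" "b \<in> ideal_pow (ideal_pt P) k" by auto
    have "vanish 1 P a" unfolding vanish_1_iff using ab(2) by (rule ideal_pt_eval3)
    moreover have "vanish k P b" using ab(3) by (rule Suc.IH)
    ultimately have "vanish (Suc k) P s" using vanish_mult[of 1 P a k b] ab(1) by simp
    then show ?case by (rule vanish_mult_left)
  qed (auto intro: vanish_zero vanish_add)
qed (rule vanish_0)

section \<open>Linear forms\<close>

definition lin :: "'a::comm_ring_1 \<times> 'a \<times> 'a \<Rightarrow> 'a poly3" where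
  "lin u = Poly_Mapping.single (1, 0, 0) (fst u) + Poly_Mapping.single (0, 1, 0) (fst (snd u))
     + Poly_Mapping.single (0, 0, 1) (snd (snd u))"

lemma homogeneous_lin: "homogeneous 1 (lin u)"
  unfolding lin_def by (intro homogeneous_add homogeneous_single) (auto simp: mdeg_def)

lemma subst3_lin:
  assumes "comm_ring_hom \<phi>"
  shows "subst3 \<phi> p (lin u) = \<phi> (fst u) * fst p + \<phi> (fst (snd u)) * fst (snd p) + \<phi> (snd (snd u)) * snd (snd p)"
  by (simp add: lin_def subst3_add[OF assms] subst3_single[OF assms])

lemma line_lin: "line P Q (lin u) = [:dot3 u P, dot3 u Q:]"
  by (simp add: line_def subst3_lin[OF comm_ring_hom_pCons] dot3_def)

lemma eval3_lin: "eval3 (lin u) P = dot3 u P"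
  by (simp add: eval3_eq_subst3 subst3_lin[OF comm_ring_hom_id] dot3_def)

lemma lin_eq_0_iff: "lin u = 0 \<longleftrightarrow> u = 0"
proof
  assume "lin u = 0"
  then have "Poly_Mapping.lookup (lin u) (1, 0, 0) = 0" "Poly_Mapping.lookup (lin u) (0, 1, 0) = 0"
    "Poly_Mapping.lookup (lin u) (0, 0, 1) = 0" by simp_all
  then show "u = 0" by (simp add: lin_def lookup_add lookup_single prod_eq_iff)
qed (simp add: lin_def)

lemma homogeneous_1_lin:
  assumes "homogeneous 1 f"
  shows "\<exists>u. f = lin u"
proof -
  have zero: "Poly_Mapping.lookup f (i, j, l) = 0" if "i + j + l \<noteq> 1" for i j l
  proof -
    have "(i, j, l) \<notin> Poly_Mapping.keys f"
      using assms that by (force simp: homogeneous_def mdeg_def)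
    then show ?thesis by (simp add: in_keys_iff)
  qed
  have "f = lin (Poly_Mapping.lookup f (1, 0, 0), Poly_Mapping.lookup f (0, 1, 0), Poly_Mapping.lookup f (0, 0, 1))"
  proof (intro poly_mapping_eqI)
    fix m :: mono3
    obtain i j l where m: "m = (i, j, l)" by (cases m)
    consider "i + j + l \<noteq> 1" | "m = (1, 0, 0)" | "m = (0, 1, 0)" | "m = (0, 0, 1)"
      unfolding m prod.inject by linarith
    then show "Poly_Mapping.lookup f m = Poly_Mapping.lookup (lin (Poly_Mapping.lookup f (1, 0, 0),
        Poly_Mapping.lookup f (0, 1, 0), Poly_Mapping.lookup f (0, 0, 1))) m"
      by cases (use zero in \<open>auto simp: m lin_def lookup_add lookup_single when_def\<close>)
  qed
  then show ?thesis ..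
qed

text \<open>The three linear forms tested here vanish at \<open>P\<close>, and their values at
  \<open>Q\<close> are the 2x2 minors of \<open>P\<close> and \<open>Q\<close>. If all minors
  vanish, \<open>Q\<close> is a multiple of \<open>P\<close>.\<close>

lemma linear_separation:
  fixes P Q :: "'a::field \<times> 'a \<times> 'a"
  assumes "P \<noteq> 0" "\<nexists>c. Q = scale3 c P"
  shows "\<exists>u. dot3 u P = 0 \<and> dot3 u Q \<noteq> 0"
proof (rule ccontr)
  assume *: "\<nexists>u. dot3 u P = 0 \<and> dot3 u Q \<noteq> 0"
  obtain a b c where P: "P = (a, b, c)" by (cases P)
  obtain x y z where Q: "Q = (x, y, z)" by (cases Q)
  have "a * y = b * x" using *[unfolded not_ex, rule_format, of "(- b, a, 0)"] by (simp add: dot3_def P Q)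
  moreover have "a * z = c * x" using *[unfolded not_ex, rule_format, of "(- c, 0, a)"] by (simp add: dot3_def P Q)
  moreover have "b * z = c * y" using *[unfolded not_ex, rule_format, of "(0, - c, b)"] by (simp add: dot3_def P Q)
  ultimately have "Q = scale3 (x / a) P" if "a \<noteq> 0" 
    using that by (simp add: scale3_def P Q field_simps)
  moreover have "Q = scale3 (y / b) P" if "b \<noteq> 0" 
    using that \<open>a * y = b * x\<close> \<open>b * z = c * y\<close> by (simp add: scale3_def P Q field_simps)
  moreover have "Q = scale3 (z / c) P" if "c \<noteq> 0" 
    using that \<open>a * z = c * x\<close> \<open>b * z = c * y\<close> by (simp add: scale3_def P Q field_simps)
  ultimately show False using assms by (auto simp: P zero_prod_def)
qed

text \<open>When one coordinate of \<open>P\<close> is nonzero, the unit vectors of the other two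
  coordinates span a complement of the line spanned by \<open>P\<close>.\<close>

lemma complement_basis:
  fixes P :: "'a::field \<times> 'a \<times> 'a"
  assumes "P \<noteq> 0"
  shows "\<exists>Q R. \<forall>\<alpha> \<beta> c. scale3 \<alpha> Q + scale3 \<beta> R = scale3 c P \<longrightarrow> \<alpha> = 0 \<and> \<beta> = 0"
proof -
  obtain x y z where P: "P = (x, y, z)" by (cases P)
  consider "x \<noteq> 0" | "y \<noteq> 0" | "z \<noteq> 0" using assms by (auto simp: P zero_prod_def)
  then show ?thesis
  proof cases
    case 1
    then show ?thesis by (intro exI[of _ "(0, 1, 0)"] exI[of _ "(0, 0, 1)"]) (auto simp: scale3_def P)
  next
    case 2
    then show ?thesis by (intro exI[of _ "(1, 0, 0)"] exI[of _ "(0, 0, 1)"]) (auto simp: scale3_def P)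
  next
    case 3
    then show ?thesis by (intro exI[of _ "(1, 0, 0)"] exI[of _ "(0, 1, 0)"]) (auto simp: scale3_def P)
  qed
qed

text \<open>The coefficient of order \<open>c\<close> of f(P + t Q), as Q runs through a plane
  complementary to \<open>P\<close>, restricts to a polynomial in the slope \<open>s\<close>.
  Algebraic closedness gives a zero unless this polynomial is constant.\<close>

lemma tangent_direction:
  fixes f :: "'a::field_char_0 poly3"
  assumes ac: "alg_closed_field TYPE('a)" and P: "P \<noteq> 0" and c: "c > 0"
  shows "\<exists>Q. (\<nexists>r. Q = scale3 r P) \<and> coeff (line P Q f) c = 0"
proof -
  obtain Q R where QR: "\<And>\<alpha> \<beta> r. scale3 \<alpha> Q + scale3 \<beta> R = scale3 r P \<Longrightarrow> \<alpha> = 0 \<and> \<beta> = 0"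
    using complement_basis[OF P] by metis
  have one: "scale3 1 X = X" for X :: "'a \<times> 'a \<times> 'a" by (simp add: scale3_def)
  define p where "p = coeff (pencil P Q R f) c"
  show ?thesis
  proof (cases "degree p > 0")
    case True
    then obtain s where "poly p s = 0" using ac unfolding alg_closed_field_def by blast
    then have "coeff (line P (Q + scale3 s R) f) c = 0"
      by (simp add: coeff_line_pencil p_def)
    moreover have "\<nexists>r. Q + scale3 s R = scale3 r P"
      using QR[of 1 s] by (auto simp: one)
    ultimately show ?thesis by blast
  next
    case False
    then obtain \<kappa> where \<kappa>: "p = [:\<kappa>:]" by (meson degree_eq_zeroE neq0_conv)
    \<comment> \<open>A form of positive degree on the pencil that is constant on \<open>Q + s R\<close> vanishes at \<open>R\<close>.\<close>
    define q where "q = coeff (pencil P R Q f) c"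
    have "poly q u = \<kappa> * u ^ c" if "u \<noteq> 0" for u
    proof -
      have "R + scale3 u Q = scale3 u (Q + scale3 (1 / u) R)"
        using that by (simp add: scale3_def prod_eq_iff field_simps)
      then have "poly q u = u ^ c * poly p (1 / u)"
        unfolding q_def p_def coeff_line_pencil[symmetric] by (simp add: coeff_line_scale)
      then show ?thesis by (simp add: \<kappa>)
    qed
    \<comment> \<open>The factor \<open>[:0, 1:]\<close> covers \<open>u = 0\<close>, the one value
      that the preceding identity leaves out.\<close>
    then have "\<forall>u. poly ((q - monom \<kappa> c) * [:0, 1:]) u = 0"
      by (auto simp: poly_monom)
    then have "(q - monom \<kappa> c) * [:0, 1:] = 0" using poly_all_0_iff_0 by blast
    then have "q = monom \<kappa> c" by simp
    then have "coeff (line P (R + scale3 0 Q) f) c = 0"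
      unfolding coeff_line_pencil using c by (simp flip: q_def add: poly_monom)
    moreover have "R + scale3 0 Q = R" by (simp add: scale3_def prod_eq_iff)
    moreover have "\<nexists>r. R = scale3 r P"
      using QR[of 0 1] by (auto simp: one scale3_def prod_eq_iff)
    ultimately show ?thesis by metis
  qed
qed

lemma eval3_mult: "eval3 (f * g) P = eval3 f P * eval3 g P"
  by (simp add: eval3_eq_subst3 subst3_mult[OF comm_ring_hom_id])

lemma eval3_power: "eval3 (f ^ k) P = eval3 f P ^ k"
  by (induction k) (simp_all add: eval3_mult, simp add: eval3_eq_subst3 subst3_one[OF comm_ring_hom_id])

text \<open>For each \<open>Q\<close>, take the power \<open>m Q\<close> of a linear form through
  \<open>Q\<close> that misses \<open>P\<close>; a further linear form missing \<open>P\<close>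
  fills the degree up to \<open>N\<close>.\<close>

lemma separating_form:
  fixes Z :: "('a::field \<times> 'a \<times> 'a) set"
  assumes "finite Z" "\<And>Q. Q \<in> Z \<Longrightarrow> Q \<noteq> 0" "P \<noteq> 0" "\<And>Q. Q \<in> Z \<Longrightarrow> \<nexists>c. P = scale3 c Q"
    and "(\<Sum>Q\<in>Z. m Q) \<le> N"
  shows "\<exists>U. homogeneous N U \<and> eval3 U P \<noteq> 0 \<and> (\<forall>Q\<in>Z. vanish (m Q) Q U)"
proof -
  have "\<exists>U. homogeneous (\<Sum>Q\<in>Z. m Q) U \<and> eval3 U P \<noteq> 0 \<and> (\<forall>Q\<in>Z. vanish (m Q) Q U)"
    using assms(1,2,4)
  proof (induction Z rule: finite_induct)
    case empty
    then show ?case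
      by (intro exI[of _ 1]) (simp add: homogeneous_one eval3_eq_subst3 subst3_one[OF comm_ring_hom_id])
  next
    case (insert Q Z)
    then obtain U where U: "homogeneous (\<Sum>Q\<in>Z. m Q) U" "eval3 U P \<noteq> 0" "\<forall>Q\<in>Z. vanish (m Q) Q U"
      by auto
    obtain u where u: "dot3 u Q = 0" "dot3 u P \<noteq> 0"
      using linear_separation[of Q P] insert.prems by blast
    have "vanish (m Q * 1) Q (lin u ^ m Q)"
      using u by (intro vanish_power) (simp only: vanish_1_iff eval3_lin)
    then show ?case using U u insert.hyps homogeneous_power[OF homogeneous_lin[of u], of "m Q"]
      by (intro exI[of _ "lin u ^ m Q * U"])
        (auto simp: eval3_mult eval3_power eval3_lin intro: homogeneous_mult vanish_mult_left vanish_mult_right)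
  qed
  then obtain U where U: "homogeneous (\<Sum>Q\<in>Z. m Q) U" "eval3 U P \<noteq> 0" "\<forall>Q\<in>Z. vanish (m Q) Q U"
    by auto
  obtain h where h: "dot3 h P \<noteq> 0"
  proof -
    obtain x y z where "P = (x, y, z)" by (cases P)
    then show ?thesis
      using assms(3) that[of "(1, 0, 0)"] that[of "(0, 1, 0)"] that[of "(0, 0, 1)"]
      by (auto simp: dot3_def zero_prod_def)
  qed
  let ?k = "N - (\<Sum>Q\<in>Z. m Q)"
  have "homogeneous (?k * 1 + (\<Sum>Q\<in>Z. m Q)) (lin h ^ ?k * U)"
    using U by (intro homogeneous_mult homogeneous_power homogeneous_lin)
  then show ?thesis using U h assms(5)
    by (intro exI[of _ "lin h ^ ?k * U"])
      (auto simp: eval3_mult eval3_power eval3_lin intro: vanish_mult_left)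
qed

lemma line_const: "line P Q (Poly_Mapping.single 0 c) = [:c:]"
  by (simp add: line_def subst3_single[OF comm_ring_hom_pCons])

lemma coeff_line_const_mult:
  "coeff (line P Q (Poly_Mapping.single 0 c * f)) i = c * coeff (line P Q f) i"
  by (simp add: line.hom_mult line_const)

lemma coeff_line_sum: "coeff (line P Q (sum f A)) i = (\<Sum>x\<in>A. coeff (line P Q (f x)) i)"
  by (simp add: line.hom_sum coeff_sum)

text \<open>Each monomial of degree \<open>n\<close> gives one linear condition, so there are fewer
  conditions than coefficients.\<close>

lemma linear_relation:
  fixes v :: "'i \<Rightarrow> 'a::field poly3"
  assumes "finite I" "\<And>i. i \<in> I \<Longrightarrow> homogeneous n (v i)" "card {m. mdeg m = n} < card I"
  shows "\<exists>c. (\<exists>i\<in>I. c i \<noteq> 0) \<and> (\<Sum>i\<in>I. Poly_Mapping.single 0 (c i) * v i) = 0"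
proof -
  obtain c where c: "\<exists>i\<in>I. c i \<noteq> 0"
    "\<And>m. mdeg m = n \<Longrightarrow> (\<Sum>i\<in>I. Poly_Mapping.lookup (v i) m * c i) = 0"
    using underdetermined_system[OF monomials_finite assms(1,3), of "\<lambda>m i. Poly_Mapping.lookup (v i) m"]
    by auto
  have "(\<Sum>i\<in>I. Poly_Mapping.single 0 (c i) * v i) = 0"
  proof (rule poly_mapping_eqI)
    fix m :: mono3
    have "(\<Sum>i\<in>I. Poly_Mapping.lookup (v i) m * c i) = 0"
    proof (cases "mdeg m = n")
      case False
      then have "Poly_Mapping.lookup (v i) m = 0" if "i \<in> I" for i
        using assms(2)[OF that] by (auto simp: homogeneous_def in_keys_iff)
      then show ?thesis by simp
    qed (rule c)
    then have "(\<Sum>i\<in>I. c i * Poly_Mapping.lookup (v i) m) = 0" by (simp only: mult.commute)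
    then show "Poly_Mapping.lookup (\<Sum>i\<in>I. Poly_Mapping.single 0 (c i) * v i) m = Poly_Mapping.lookup 0 m"
      by (simp add: lookup_sum lookup_const_mult)
  qed
  then show ?thesis using c(1) by blast
qed

lemma lookup_sum_single:
  assumes "finite A"
  shows "Poly_Mapping.lookup (\<Sum>m\<in>A. Poly_Mapping.single m (c m)) k = (if k \<in> A then c k else 0)"
proof -
  have "Poly_Mapping.lookup (\<Sum>m\<in>A. Poly_Mapping.single m (c m)) k = (\<Sum>m\<in>A. if k = m then c k else 0)"
    unfolding lookup_sum by (intro sum.cong) (auto simp: lookup_single)
  then show ?thesis using assms by simp
qed

section \<open>A Bezout inequality\<close>

text \<open>If \<open>C\<close> has order \<open>c\<close> at \<open>P\<close> and \<open>Q\<close> is a tangent direction, then every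
  multiple of \<open>C\<close> has order one more than expected along \<open>Q\<close>.\<close>
lemma tangent_multiples:
  fixes C :: "'a::field_char_0 poly3"
  assumes ac: "alg_closed_field TYPE('a)" and P: "P \<noteq> 0" and C: "eval3 C P = 0"
  shows "\<exists>u Q. dot3 u P = 0 \<and> dot3 u Q \<noteq> 0 \<and>
    (\<forall>B j. j < m \<longrightarrow> vanish j P (C * B) \<longrightarrow> coeff (line P Q (C * B)) j = 0)"
proof -
  have "\<exists>Q. (\<nexists>r. Q = scale3 r P) \<and>
    (\<forall>B j. j < m \<longrightarrow> vanish j P (C * B) \<longrightarrow> coeff (line P Q (C * B)) j = 0)"
  proof (cases "vanish m P C")
    case True
    then show ?thesis
      using tangent_direction[OF ac P, of 1 C] vanishD[OF vanish_mult_right[OF True]] by auto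
  next
    case False
    then obtain c where c: "c < m" "vanish c P C" "\<not> vanish (Suc c) P C"
      by (rule vanish_order_below)
    have "c \<noteq> 0" using c(3) C vanish_1_iff[of P C] by (metis One_nat_def)
    then obtain Q where Q: "\<nexists>r. Q = scale3 r P" "coeff (line P Q C) c = 0"
      using tangent_direction[OF ac P, of c C] by blast
    have "coeff (line P Q (C * B)) j = 0" if "vanish j P (C * B)" for B j
      unfolding line.hom_mult
    proof (rule coeff_mult_low(1))
      show "coeff (line P Q C) i = 0" if "i < Suc c" for i
        using that Q(2) vanishD[OF c(2)] by (cases "i = c") auto
      show "coeff (line P Q B) i = 0" if "i < j - c" for i
        by (rule vanishD[OF vanish_factor[OF \<open>vanish j P (C * B)\<close> c(3)] that])
    qed auto
    then show ?thesis using Q(1) by blast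
  qed
  then show ?thesis using linear_separation[OF P] by metis
qed

text \<open>Independence of the three families is shown by clearing a relation
  \<open>G * A + (C * B + S) = 0\<close> in turn: first the coefficients of the local forms in
  \<open>S\<close>, then \<open>B\<close>, then \<open>A\<close>.\<close>

lemma bezout_points:
  fixes Z :: "('a::field_char_0 \<times> 'a \<times> 'a) set" and G C :: "'a poly3"
  assumes ac: "alg_closed_field TYPE('a)" and fin: "finite Z"
    and nz: "\<And>P. P \<in> Z \<Longrightarrow> P \<noteq> 0"
    and dist: "\<And>P Q. P \<in> Z \<Longrightarrow> Q \<in> Z \<Longrightarrow> P \<noteq> Q \<Longrightarrow> \<nexists>c. P = scale3 c Q"
    and G: "G \<noteq> 0" "homogeneous g G" and C: "homogeneous a C"
    and prime: "\<And>A B. G dvd A * B \<Longrightarrow> G dvd A \<or> G dvd B" and ndvd: "\<not> G dvd C"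
    and CZ: "\<And>P. P \<in> Z \<Longrightarrow> eval3 C P = 0" and GZ: "\<And>P. P \<in> Z \<Longrightarrow> vanish (m P) P G"
  shows "(\<Sum>P\<in>Z. m P) \<le> a * g"
proof -
  define M where "M = (\<Sum>P\<in>Z. m P)"
  \<comment> \<open>Large enough for the local forms, whose prescribed zeros cost at most
    \<open>M\<close>; the cofactors of \<open>G\<close> and \<open>C\<close> get the degrees
    \<open>M + a\<close> and \<open>M + g\<close>.\<close>
  define n where "n = M + a + g"
  have "\<forall>P\<in>Z. \<exists>u Q. dot3 u P = 0 \<and> dot3 u Q \<noteq> 0 \<and>
      (\<forall>B j. j < m P \<longrightarrow> vanish j P (C * B) \<longrightarrow> coeff (line P Q (C * B)) j = 0)"
    using tangent_multiples[OF ac nz CZ] by blast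
  then obtain u T where u: "\<And>P. P \<in> Z \<Longrightarrow> dot3 (u P) P = 0" "\<And>P. P \<in> Z \<Longrightarrow> dot3 (u P) (T P) \<noteq> 0"
    and T: "\<And>P B j. P \<in> Z \<Longrightarrow> j < m P \<Longrightarrow> vanish j P (C * B) \<Longrightarrow> coeff (line P (T P) (C * B)) j = 0"
    unfolding bchoice_iff by blast
  have exU: "\<exists>U. homogeneous (n - j) U \<and> eval3 U P \<noteq> 0 \<and> (\<forall>Q\<in>Z - {P}. vanish (m Q) Q U)"
    if "P \<in> Z" "j < m P" for P j
  proof -
    have "(\<Sum>Q\<in>Z - {P}. m Q) \<le> n - j"
      using that fin by (simp add: n_def M_def sum.remove)
    moreover have "\<nexists>c. P = scale3 c Q" if "Q \<in> Z - {P}" for Q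
      using that by (intro dist \<open>P \<in> Z\<close>) auto
    ultimately show ?thesis using that fin nz by (intro separating_form) blast+
  qed
  define U where "U = (\<lambda>P j. SOME U. homogeneous (n - j) U \<and> eval3 U P \<noteq> 0 \<and>
      (\<forall>Q\<in>Z - {P}. vanish (m Q) Q U))"
  have U_all: "homogeneous (n - j) (U P j) \<and> eval3 (U P j) P \<noteq> 0 \<and> (\<forall>Q\<in>Z - {P}. vanish (m Q) Q (U P j))"
    if "P \<in> Z" "j < m P" for P j
    unfolding U_def by (rule someI_ex[OF exU[OF that]])
  have U: "homogeneous (n - j) (U P j)" "eval3 (U P j) P \<noteq> 0"
    "Q \<in> Z \<Longrightarrow> Q \<noteq> P \<Longrightarrow> vanish (m Q) Q (U P j)" if "P \<in> Z" "j < m P" for P Q j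
    using U_all[OF that] by auto
  \<comment> \<open>The local form \<open>f (P, j)\<close> has order \<open>j\<close> at
    \<open>P\<close>, with nonzero coefficient \<open>j\<close> along \<open>T P\<close>, and order
    at least \<open>m Q\<close> at every other point \<open>Q\<close>.\<close>
  define f where "f = (\<lambda>(P, j). lin (u P) ^ j * U P j)"
  define E where "E = Sigma Z (\<lambda>P. {..<m P})"
  have finE: "finite E" using fin by (simp add: E_def)
  have f_hom: "homogeneous n (f x)" if "x \<in> E" for x
  proof -
    obtain P j where x: "x = (P, j)" "P \<in> Z" "j < m P" using \<open>x \<in> E\<close> by (auto simp: E_def)
    have "m P \<le> M" unfolding M_def using fin x by (intro member_le_sum) auto
    then have "j * 1 + (n - j) = n" using x by (simp add: n_def)
    then show ?thesis
      using homogeneous_mult[OF homogeneous_power[OF homogeneous_lin, of j "u P"] U(1)[OF x(2,3)]]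
      by (simp only: f_def x prod.case)
  qed
  have f_other: "vanish (m Q) Q (f (P, j))" if "(P, j) \<in> E" "Q \<in> Z" "Q \<noteq> P" for P Q j
  proof -
    have "P \<in> Z" "j < m P" using that(1) by (auto simp: E_def)
    from U(3)[OF this that(2,3)] show ?thesis by (simp add: f_def vanish_mult_left)
  qed
  have f_van: "vanish j P (f (P, j))" if "(P, j) \<in> E" for P j
  proof -
    have "vanish 1 P (lin (u P))"
      unfolding vanish_1_iff eval3_lin using that by (intro u(1)) (auto simp: E_def)
    from vanish_power[OF this, of j] show ?thesis by (simp add: f_def vanish_mult_right)
  qed
  have f_coeff: "coeff (line P (T P) (f (P, j))) j \<noteq> 0" if "(P, j) \<in> E" for P j
  proof -
    have P: "P \<in> Z" "j < m P" using that by (auto simp: E_def)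
    have "line P (T P) (f (P, j)) = monom (dot3 (u P) (T P) ^ j) j * line P (T P) (U P j)"
      using u(1)[OF P(1)] by (simp add: f_def line.hom_mult line.hom_power line_lin linear_power)
    then show ?thesis using u(2)[OF P(1)] U(2)[OF P] by (simp add: coeff_monom_mult coeff_line_0)
  qed
  define I1 where "I1 = {k. mdeg k = n - g}"
  \<comment> \<open>Omitting the multiples of \<open>lm G\<close> keeps the multiples of
    \<open>C\<close> independent of those of \<open>G\<close>.\<close>
  define I2 where "I2 = {k. mdeg k = n - a \<and> (\<nexists>l. k = lm G + l)}"
  have fin12: "finite I1" "finite I2"
    unfolding I1_def I2_def by (auto intro: monomials_finite finite_subset[OF _ monomials_finite[of "n - a"]])
  define v where "v = case_sum (\<lambda>k. G * Poly_Mapping.single k 1)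
      (case_sum (\<lambda>k. C * Poly_Mapping.single k 1) f)"
  have "\<not> card {k. mdeg k = n} < card (I1 <+> (I2 <+> E))"
  proof
    assume less: "card {k. mdeg k = n} < card (I1 <+> (I2 <+> E))"
    have "homogeneous n (v i)" if "i \<in> I1 <+> (I2 <+> E)" for i
    proof -
      have "g + (n - g) = n" "a + (n - a) = n" by (simp_all add: n_def)
      then have "homogeneous n (G * Poly_Mapping.single k 1)" if "k \<in> I1" for k
        using homogeneous_mult[OF G(2) homogeneous_single, of k "n - g" 1] that by (simp add: I1_def)
      moreover have "homogeneous n (C * Poly_Mapping.single k 1)" if "k \<in> I2" for k
        using homogeneous_mult[OF C homogeneous_single, of k "n - a" 1] that \<open>a + (n - a) = n\<close>
        by (simp add: I2_def)
      ultimately show ?thesis using that f_hom unfolding v_def by (elim PlusE) simp_all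
    qed
    then obtain c where c: "\<exists>i\<in>I1 <+> (I2 <+> E). c i \<noteq> 0"
      "(\<Sum>i\<in>I1 <+> (I2 <+> E). Poly_Mapping.single 0 (c i) * v i) = 0"
      using linear_relation[OF _ _ less, of v] fin12 finE by auto
    define A where "A = (\<Sum>k\<in>I1. Poly_Mapping.single k (c (Inl k)))"
    define B where "B = (\<Sum>k\<in>I2. Poly_Mapping.single k (c (Inr (Inl k))))"
    define d where "d = (\<lambda>x. c (Inr (Inr x)))"
    define S where "S = (\<Sum>x\<in>E. Poly_Mapping.single 0 (d x) * f x)"
    have "(\<Sum>i\<in>I1 <+> (I2 <+> E). Poly_Mapping.single 0 (c i) * v i) = G * A + (C * B + S)"
      using fin12 finE
      by (simp add: sum.Plus v_def A_def B_def S_def d_def sum_distrib_left mult_single mult.left_commute)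
    then have rel: "G * A + (C * B + S) = 0" using c(2) by simp
    \<comment> \<open>Compare coefficients of t^j at \<open>P\<close> along \<open>T P\<close>.
      Local forms at other points or with larger index contribute nothing, those with smaller index
      are gone by induction, \<open>G * A\<close> has order at least \<open>m P > j\<close>, and the
      tangent direction kills \<open>C * B\<close>. Only \<open>d (P, j)\<close> times a nonzero
      number remains.\<close>
    have "d (P, j) = 0" if "(P, j) \<in> E" for P j
      using that
    proof (induction j rule: less_induct)
      case (less j)
      have P: "P \<in> Z" "j < m P" using less.prems by (auto simp: E_def)
      have summand: "vanish j P (Poly_Mapping.single 0 (d x) * f x) \<and>
          (x \<noteq> (P, j) \<longrightarrow> coeff (line P (T P) (Poly_Mapping.single 0 (d x) * f x)) j = 0)"
        if x: "x \<in> E" for x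
      proof -
        obtain R i where R: "x = (R, i)" by (cases x)
        consider "R \<noteq> P" | "R = P" "i < j" | "R = P" "i \<ge> j" by force
        then show ?thesis
        proof cases
          case 1
          then have van: "vanish (m P) P (Poly_Mapping.single 0 (d x) * f x)"
            using x P(1) unfolding R by (intro vanish_mult_left f_other) auto
          show ?thesis using vanishD[OF van P(2)] vanish_mono[OF van] P(2) by simp
        next
          case 2
          then have "d x = 0" using less.IH[of i] x by (simp add: R)
          then show ?thesis by (simp add: vanish_zero)
        next
          case 3
          have van: "vanish i P (Poly_Mapping.single 0 (d x) * f x)"
            using x 3(1) unfolding R by (intro vanish_mult_left) (simp add: f_van)
          have "i > j" if "x \<noteq> (P, j)" using that 3 by (auto simp: R)
          then show ?thesis using vanish_mono[OF van 3(2)] vanishD[OF van, of j "T P"] by blast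
        qed
      qed
      have GA: "vanish (m P) P (G * A)" using GZ[OF P(1)] by (rule vanish_mult_right)
      \<comment> \<open>The relation itself forces \<open>C * B\<close> to vanish to order
        \<open>j\<close> at \<open>P\<close>, as the property of \<open>T P\<close> demands.\<close>
      have "C * B = - (G * A + S)" using rel by (simp add: algebra_simps eq_neg_iff_add_eq_0)
      moreover have "vanish j P S" unfolding S_def using summand by (intro vanish_sum) blast
      ultimately have "vanish j P (C * B)"
        using P(2) vanish_mono[OF GA, of j] by (simp only: vanish_uminus vanish_add less_imp_le)
      then have "coeff (line P (T P) (C * B)) j = 0" by (rule T[OF P])
      moreover have "coeff (line P (T P) (G * A)) j = 0" using vanishD[OF GA P(2)] .
      moreover have "coeff (line P (T P) (G * A + (C * B + S))) j = 0" by (simp add: rel)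
      ultimately have "coeff (line P (T P) S) j = 0" by (simp add: line.hom_add)
      also have "coeff (line P (T P) S) j =
          (\<Sum>x\<in>E. if x = (P, j) then d (P, j) * coeff (line P (T P) (f (P, j))) j else 0)"
        unfolding S_def coeff_line_sum using summand by (intro sum.cong) (auto simp: coeff_line_const_mult)
      finally show ?case using less.prems finE f_coeff[OF less.prems] by simp
    qed
    then have d0: "d x = 0" if "x \<in> E" for x using that by (cases x) auto
    then have "S = 0" by (simp add: S_def)
    then have GACB: "G * A = - (C * B)" using rel by (simp add: eq_neg_iff_add_eq_0)
    have lookA: "Poly_Mapping.lookup A k = (if k \<in> I1 then c (Inl k) else 0)" for k
      unfolding A_def by (rule lookup_sum_single[OF fin12(1)])
    have lookB: "Poly_Mapping.lookup B k = (if k \<in> I2 then c (Inr (Inl k)) else 0)" for k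
      unfolding B_def by (rule lookup_sum_single[OF fin12(2)])
    \<comment> \<open>By primality \<open>G\<close> would divide \<open>B\<close>, making
      \<open>lm B\<close> a multiple of \<open>lm G\<close>; but no monomial of \<open>B\<close> is
      one.\<close>
    have "B = 0"
    proof (rule ccontr)
      assume B: "B \<noteq> 0"
      have "G dvd C * B" using GACB by (metis dvd_minus_iff dvd_triv_left)
      then have "G dvd B" using prime ndvd by blast
      then obtain H where H: "B = G * H" ..
      then have "lm B = lm G + lm H" using B G(1) by (auto intro: lm_mult)
      moreover have "lm B \<in> I2"
        using lm_in_keys[OF B] by (auto simp: in_keys_iff lookB split: if_splits)
      ultimately show False unfolding I2_def by blast
    qed
    moreover from this have "A = 0" using GACB G(1) by (simp add: poly3_mult_eq_0_iff)
    ultimately have "c (Inl k) = 0" if "k \<in> I1" for k using lookA[of k] that by simp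
    moreover have "c (Inr (Inl k)) = 0" if "k \<in> I2" for k using lookB[of k] that \<open>B = 0\<close> by simp
    ultimately show False using c(1) d0 by (auto simp: d_def elim!: PlusE)
  qed
  then have "card I1 + card I2 + M \<le> card {k. mdeg k = n}"
    using fin12 finE fin by (simp add: card_Plus E_def M_def)
  moreover have "card I2 + card {k. mdeg k = M} = card {k. mdeg k = M + g}"
    using card_monomials_not_multiple[OF homogeneous_mdeg_lm[OF G(2,1)], of M]
    by (simp add: I2_def n_def)
  moreover have "2 * card I1 = (M + a + 1) * (M + a + 2)"
    using card_monomials[of "M + a"] by (simp add: I1_def n_def)
  ultimately have "(M + a + 1) * (M + a + 2) + (M + g + 1) * (M + g + 2) + 2 * M
      \<le> (M + 1) * (M + 2) + (n + 1) * (n + 2)"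
    unfolding card_monomials[symmetric] by linarith
  \<comment> \<open>With N(t) = (t + 1) (t + 2) / 2 the inequality reads M \<le> N(M + a + g) - N(M
    + a) - N(M + g) + N(M), and this second difference equals a g.\<close>
  then have "M \<le> a * g" by (simp add: n_def algebra_simps)
  then show ?thesis by (simp add: M_def)
qed

section \<open>Forms through the points without a common factor\<close>

text \<open>By degrees, a form of positive degree dividing a nonzero linear form is linear and
  proportional to it. So the linear forms divisible by \<open>G\<close> span at most one
  dimension.\<close>

lemma dvd_lin_multiple:
  fixes G :: "'a::field poly3"
  assumes G: "homogeneous g G" "g > 0"
  shows "\<exists>x. \<forall>u. G dvd lin u \<longrightarrow> (\<exists>c. u = scale3 c x)"
proof (cases "\<exists>x. x \<noteq> 0 \<and> G dvd lin x")
  case False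
  then show ?thesis by (intro exI[of _ 0]) (auto simp: scale3_def zero_prod_def intro!: exI[of _ 0])
next
  case True
  then obtain x H where x: "x \<noteq> 0" "lin x = G * H" by (auto elim: dvdE)
  have const: "\<exists>c. H = Poly_Mapping.single 0 c" and g1: "g = 1"
    if u: "u \<noteq> 0" "lin u = G * H" for u H
  proof -
    have nz: "G * H \<noteq> 0" using u lin_eq_0_iff[of u] by simp
    then obtain i j where ij: "homogeneous i G" "homogeneous j H" "i + j = 1"
      using homogeneous_factors[of 1 G H] homogeneous_lin[of u] u by auto
    moreover have "G \<noteq> 0" using nz by auto
    then have "i = g"
      using homogeneous_mdeg_lm[OF ij(1)] homogeneous_mdeg_lm[OF G(1)] by simp
    ultimately show "g = 1" using G(2) by simp
    with ij \<open>i = g\<close> have "homogeneous 0 H" by simp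
    then show "\<exists>c. H = Poly_Mapping.single 0 c" using homogeneous_0_const by blast
  qed
  obtain y where y: "G = lin y" using g1[OF x] G(1) homogeneous_1_lin by blast
  have "\<exists>c. u = scale3 c y" if "G dvd lin u" for u
  proof (cases "u = 0")
    case True
    then show ?thesis by (intro exI[of _ 0]) (simp add: scale3_def zero_prod_def)
  next
    case False
    from that obtain H where H: "lin u = G * H" ..
    obtain c where c: "H = Poly_Mapping.single 0 c" using const[OF False H] by blast
    have "G * H = lin (scale3 c y)"
      by (simp add: y c lin_def scale3_def algebra_simps mult_single)
    then have "lin (u - scale3 c y) = 0"
      using H by (simp add: lin_def single_diff algebra_simps)
    then have "u = scale3 c y" by (simp add: lin_eq_0_iff)
    then show ?thesis ..
  qed
  then show ?thesis by blast
qed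

lemma eval3_add: "eval3 (f + g) P = eval3 f P + eval3 g P"
  by (simp add: eval3_eq_subst3 subst3_add[OF comm_ring_hom_id])

lemma eval3_sum: "eval3 (sum f A) P = (\<Sum>i\<in>A. eval3 (f i) P)"
  by (simp add: eval3_eq_subst3 subst3_sum[OF comm_ring_hom_id])

lemma eval3_const: "eval3 (Poly_Mapping.single 0 c) P = c"
  by (simp add: eval3_eq_subst3 subst3_single[OF comm_ring_hom_id])

lemma eval3_zero: "eval3 0 P = 0"
  by (simp add: eval3_def)

text \<open>If \<open>G\<close> divided every form of degree \<open>d + 1\<close> through \<open>Z\<close>, then it would divide the
  separators of \<open>Z\<close>, since these may be multiplied by two independent linear forms through a point;
  but the separators span all forms of degree \<open>d\<close>.\<close>
lemma form_through_points_not_multiple: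
  fixes Z :: "('a::field \<times> 'a \<times> 'a) set" and G :: "'a poly3"
  assumes fin: "finite Z" and nz: "\<And>P. P \<in> Z \<Longrightarrow> P \<noteq> 0" and d: "d > 0"
    and unisolvent: "\<And>f. homogeneous d f \<Longrightarrow> \<forall>P\<in>Z. eval3 f P = 0 \<Longrightarrow> f = 0"
    and separators: "\<And>P. P \<in> Z \<Longrightarrow> \<exists>S. homogeneous d S \<and> eval3 S P \<noteq> 0 \<and> (\<forall>Q\<in>Z - {P}. eval3 S Q = 0)"
    and G: "homogeneous g G" "g > 0"
    and prime: "\<And>A B. G dvd A * B \<Longrightarrow> G dvd A \<or> G dvd B"
  shows "\<exists>C. homogeneous (Suc d) C \<and> (\<forall>P\<in>Z. eval3 C P = 0) \<and> \<not> G dvd C"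
proof (rule ccontr)
  assume "\<not> ?thesis"
  then have all: "G dvd C" if "homogeneous (Suc d) C" "\<forall>P\<in>Z. eval3 C P = 0" for C
    using that by blast
  obtain x where x: "\<And>u. G dvd lin u \<Longrightarrow> \<exists>c. u = scale3 c x"
    using dvd_lin_multiple[OF G] by blast
  obtain S where S: "\<And>P. P \<in> Z \<Longrightarrow> homogeneous d (S P)" "\<And>P. P \<in> Z \<Longrightarrow> eval3 (S P) P \<noteq> 0"
    "\<And>P Q. P \<in> Z \<Longrightarrow> Q \<in> Z \<Longrightarrow> Q \<noteq> P \<Longrightarrow> eval3 (S P) Q = 0"
  proof -
    have "\<forall>P\<in>Z. \<exists>S. homogeneous d S \<and> eval3 S P \<noteq> 0 \<and> (\<forall>Q\<in>Z - {P}. eval3 S Q = 0)"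
      using separators by blast
    then show thesis unfolding bchoice_iff using that by blast
  qed
  have dvdS: "G dvd S P" if P: "P \<in> Z" for P
  proof (rule ccontr)
    assume ndvd: "\<not> G dvd S P"
    have "G dvd lin u" if "dot3 u P = 0" for u
    proof -
      have "homogeneous (1 + d) (lin u * S P)"
        by (rule homogeneous_mult[OF homogeneous_lin S(1)[OF P]])
      moreover have "eval3 (lin u * S P) Q = 0" if "Q \<in> Z" for Q
        using S(3)[OF P that] \<open>dot3 u P = 0\<close> by (cases "Q = P") (simp_all add: eval3_mult eval3_lin)
      ultimately have "G dvd lin u * S P" using all by simp
      then show ?thesis using prime ndvd by blast
    qed
    then have mult: "\<exists>c. u = scale3 c x" if "dot3 u P = 0" for u using x that by blast
    obtain p q r where Pc: "P = (p, q, r)" by (cases P)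
    \<comment> \<open>These three forms span the linear forms through \<open>P\<close>, a space of
      dimension two if \<open>P \<noteq> 0\<close>, so they cannot all be multiples of
      \<open>x\<close>.\<close>
    obtain c1 where c1: "(- q, p, 0) = scale3 c1 x" using mult[of "(- q, p, 0)"] by (auto simp: Pc dot3_def)
    obtain c2 where c2: "(- r, 0, p) = scale3 c2 x" using mult[of "(- r, 0, p)"] by (auto simp: Pc dot3_def)
    obtain c3 where c3: "(0, - r, q) = scale3 c3 x" using mult[of "(0, - r, q)"] by (auto simp: Pc dot3_def)
    obtain x1 x2 x3 where xc: "x = (x1, x2, x3)" by (cases x)
    have "P = 0" using c1 c2 c3 unfolding xc scale3_def Pc zero_prod_def by auto
    then show False using nz P by blast
  qed
  have dvd: "G dvd f" if f: "homogeneous d f" for f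
  proof -
    \<comment> \<open>\<open>h\<close> interpolates \<open>f\<close> on \<open>Z\<close> by the
      separators, hence equals \<open>f\<close> by unisolvence.\<close>
    define h where "h = (\<Sum>P\<in>Z. Poly_Mapping.single 0 (eval3 f P / eval3 (S P) P) * S P)"
    have "homogeneous d (f - h)" unfolding h_def
      by (intro homogeneous_diff homogeneous_sum homogeneous_const_mult f S(1))
    moreover have "eval3 (f - h) Q = 0" if Q: "Q \<in> Z" for Q
    proof -
      have "eval3 h Q = (\<Sum>P\<in>Z. if P = Q then eval3 f Q else 0)"
        unfolding h_def eval3_sum eval3_mult eval3_const
        using S(2)[OF Q] S(3)[OF _ Q] by (intro sum.cong) auto
      then have "eval3 h Q = eval3 f Q" using fin Q by simp
      then show ?thesis using eval3_add[of "f - h" h Q] by simp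
    qed
    ultimately have "f - h = 0" by (intro unisolvent) blast+
    moreover have "G dvd h" unfolding h_def using dvdS by (intro dvd_sum) simp
    ultimately show ?thesis by simp
  qed
  have prime_power: "G dvd f" if "G dvd f ^ k" for f k
    using that
  proof (induction k)
    case 0
    then show ?case using dvd_trans one_dvd by (metis power_0)
  qed (use prime in auto)
  \<comment> \<open>As \<open>lin u ^ d\<close> has degree \<open>d\<close>, every linear form would
    be divisible by \<open>G\<close> and hence a multiple of the single \<open>x\<close>.\<close>
  have "G dvd lin u" for u
    using dvd[of "lin u ^ d"] homogeneous_power[OF homogeneous_lin, of d u] prime_power by simp
  then have "\<exists>c. u = scale3 c x" for u by (rule x)
  then obtain c1 c2 where "(1, 0, 0) = scale3 c1 x" "(0, 1, 0) = scale3 c2 x" by metis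
  then show False by (cases x) (auto simp: scale3_def)
qed

section \<open>Multiplicities of an arbitrary form\<close>

text \<open>Induction on the degree of \<open>G\<close>. A reducible form shares its multiplicities
  and its degree between two factors; an irreducible one is prime, and \<open>bezout_points\<close>
  applies with a form of degree \<open>d + 1\<close> through \<open>Z\<close> that it does not
  divide.\<close>

lemma multiplicity_bound:
  fixes Z :: "('a::field_char_0 \<times> 'a \<times> 'a) set" and G :: "'a poly3"
  assumes ac: "alg_closed_field TYPE('a)" and fin: "finite Z"
    and nz: "\<And>P. P \<in> Z \<Longrightarrow> P \<noteq> 0"
    and dist: "\<And>P Q. P \<in> Z \<Longrightarrow> Q \<in> Z \<Longrightarrow> P \<noteq> Q \<Longrightarrow> \<nexists>c. P = scale3 c Q" and d: "d > 0"
    and unisolvent: "\<And>f. homogeneous d f \<Longrightarrow> \<forall>P\<in>Z. eval3 f P = 0 \<Longrightarrow> f = 0"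
    and separators: "\<And>P. P \<in> Z \<Longrightarrow> \<exists>S. homogeneous d S \<and> eval3 S P \<noteq> 0 \<and> (\<forall>Q\<in>Z - {P}. eval3 S Q = 0)"
    and G: "G \<noteq> 0" "homogeneous g G" and GZ: "\<And>P. P \<in> Z \<Longrightarrow> vanish (m P) P G"
  shows "(\<Sum>P\<in>Z. m P) \<le> Suc d * g"
  using G GZ
proof (induction g arbitrary: G m rule: less_induct)
  case (less g)
  note G = less.prems(1,2) and GZ = less.prems(3)
  show ?case
  proof (cases "g = 0")
    case True
    then obtain c where c: "G = Poly_Mapping.single 0 c" using homogeneous_0_const G(2) by blast
    have "m P = 0" if "P \<in> Z" for P
    proof (rule ccontr)
      assume "m P \<noteq> 0"
      then have "vanish 1 P G" using vanish_mono[OF GZ[OF that]] by simp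
      then have "c = 0" unfolding vanish_1_iff c eval3_const .
      then show False using G(1) c by simp
    qed
    then show ?thesis by simp
  next
    case g: False
    show ?thesis
    proof (cases "\<exists>A B i j. G = A * B \<and> homogeneous i A \<and> homogeneous j B \<and> i \<noteq> 0 \<and> j \<noteq> 0")
      case True
      then obtain A B i j where AB: "G = A * B" "homogeneous i A" "homogeneous j B" "i \<noteq> 0" "j \<noteq> 0"
        by blast
      have nz: "A \<noteq> 0" "B \<noteq> 0" using G(1) AB(1) by auto
      have ij: "g = i + j"
        using homogeneous_mdeg_lm[OF G(2,1)] homogeneous_mdeg_lm[OF AB(2) nz(1)]
          homogeneous_mdeg_lm[OF AB(3) nz(2)] lm_mult[OF nz] by (simp add: AB(1) mdeg_add)
      have "\<forall>P\<in>Z. \<exists>k l. k + l = m P \<and> vanish k P A \<and> vanish l P B"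
        using GZ vanish_mult_split unfolding AB(1) by blast
      then obtain k l where kl: "\<And>P. P \<in> Z \<Longrightarrow> k P + l P = m P" "\<And>P. P \<in> Z \<Longrightarrow> vanish (k P) P A"
        "\<And>P. P \<in> Z \<Longrightarrow> vanish (l P) P B"
        unfolding bchoice_iff by blast
      have "(\<Sum>P\<in>Z. k P) \<le> Suc d * i" using AB ij nz kl(2) by (intro less.IH) auto
      moreover have "(\<Sum>P\<in>Z. l P) \<le> Suc d * j" using AB ij nz kl(3) by (intro less.IH) auto
      moreover have "(\<Sum>P\<in>Z. m P) = (\<Sum>P\<in>Z. k P) + (\<Sum>P\<in>Z. l P)"
        using kl(1) by (simp flip: sum.distrib)
      ultimately show ?thesis by (simp add: ij distrib_left)
    next
      case False
      have prime: "G dvd A \<or> G dvd B" if "G dvd A * B" for A B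
        using False g by (intro homogeneous_irreducible_prime[OF G _ _ that]) blast+
      obtain C where C: "homogeneous (Suc d) C" "\<forall>P\<in>Z. eval3 C P = 0" "\<not> G dvd C"
        using form_through_points_not_multiple[OF fin nz d unisolvent separators G(2) _ prime] g by blast
      show ?thesis
        using C by (intro bezout_points[OF ac fin nz dist G C(1) prime C(3) _ GZ]) blast+
    qed
  qed
qed

section \<open>Elements of the ideals of fat points\<close>

lemma gen_ideal_mult_left: "f \<in> gen_ideal S \<Longrightarrow> r * f \<in> gen_ideal S"
proof (induction f rule: gen_ideal.induct)
  case (mult s t)
  then show ?case using gen_ideal.mult[of s S "r * t"] by (simp add: mult.assoc)
qed (auto simp: distrib_left intro: gen_ideal.zero gen_ideal.add)

lemma ideal_pow_mult_left: "f \<in> ideal_pow I k \<Longrightarrow> r * f \<in> ideal_pow I k"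
  by (cases k) (auto simp: ideal_prod_def gen_ideal_mult_left)

lemma power_in_ideal_pow: "f \<in> I \<Longrightarrow> f ^ k \<in> ideal_pow I k"
proof (induction k)
  case (Suc k)
  then have "1 * (f * f ^ k) \<in> gen_ideal {a * b |a b. a \<in> I \<and> b \<in> ideal_pow I k}"
    by (intro gen_ideal.mult) auto
  then show ?case by (simp add: ideal_prod_def)
qed simp

lemma homogeneous_in_ideal_pt: "homogeneous n f \<Longrightarrow> eval3 f P = 0 \<Longrightarrow> f \<in> ideal_pt P"
  by (simp add: ideal_pt_def hcomp_homogeneous eval3_zero)

lemma homogeneous_in_ideal_fat_1_iff:
  assumes "homogeneous n f"
  shows "f \<in> ideal_fat 1 Z \<longleftrightarrow> (\<forall>P\<in>Z. eval3 f P = 0)"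
proof
  assume "f \<in> ideal_fat 1 Z"
  then show "\<forall>P\<in>Z. eval3 f P = 0"
    using ideal_pow_vanish[of f _ 1] unfolding ideal_fat_def vanish_1_iff by blast
next
  assume "\<forall>P\<in>Z. eval3 f P = 0"
  then show "f \<in> ideal_fat 1 Z"
    using power_in_ideal_pow[OF homogeneous_in_ideal_pt[OF assms], of _ 1]
    unfolding ideal_fat_def power_one_right by blast
qed

text \<open>The product of the powers \<open>lin u ^ k\<close> of one linear form through each
  point. It guarantees that the minimum in \<open>init_deg\<close> is attained.\<close>

lemma ideal_fat_nonzero_form:
  fixes Z :: "('a::field \<times> 'a \<times> 'a) set"
  assumes "finite Z"
  shows "\<exists>n. \<exists>f\<in>ideal_fat k Z. f \<noteq> 0 \<and> homogeneous n f"
  using assms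
proof (induction Z rule: finite_induct)
  case empty
  show ?case by (intro exI[of _ 0] bexI[of _ 1]) (auto simp: ideal_fat_def homogeneous_one)
next
  case (insert P Z)
  then obtain n f where f: "f \<in> ideal_fat k Z" "f \<noteq> 0" "homogeneous n f" by blast
  obtain u where u: "u \<noteq> 0" "dot3 u P = 0"
  proof -
    obtain p q r where P: "P = (p, q, r)" by (cases P)
    show thesis
    proof (cases "p = 0")
      case True
      then show ?thesis using that[of "(1, 0, 0)"] by (simp add: P dot3_def zero_prod_def)
    next
      case False
      then show ?thesis using that[of "(- q, p, 0)"] by (simp add: P dot3_def zero_prod_def)
    qed
  qed
  have "lin u \<in> ideal_pt P"
    using u by (intro homogeneous_in_ideal_pt[OF homogeneous_lin]) (simp add: eval3_lin)
  then have "f * lin u ^ k \<in> ideal_pow (ideal_pt P) k"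
    by (intro ideal_pow_mult_left power_in_ideal_pow)
  moreover have "lin u ^ k * f \<in> ideal_fat k Z"
    using f(1) ideal_pow_mult_left unfolding ideal_fat_def by blast
  ultimately have "f * lin u ^ k \<in> ideal_fat k (insert P Z)"
    by (simp add: ideal_fat_def mult.commute)
  moreover have "homogeneous (n + k * 1) (f * lin u ^ k)"
    by (intro homogeneous_mult homogeneous_power homogeneous_lin f)
  moreover have "lin u ^ j \<noteq> 0" for j
    using u(1) by (induction j) (auto simp: poly3_mult_eq_0_iff lin_eq_0_iff)
  then have "f * lin u ^ k \<noteq> 0" using f(2) by (simp add: poly3_mult_eq_0_iff)
  ultimately show ?case by blast
qed

text \<open>With fewer points than monomials of degree \<open>d\<close>, the vanishing conditions
  would have a nonzero solution.\<close>

lemma unisolvent_card: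
  fixes Z :: "('a::field \<times> 'a \<times> 'a) set"
  assumes "finite Z" and unisolvent: "\<And>f. homogeneous d f \<Longrightarrow> \<forall>P\<in>Z. eval3 f P = 0 \<Longrightarrow> f = 0"
  shows "card {m. mdeg m = d} \<le> card Z"
proof (rule ccontr)
  let ?M = "{m. mdeg m = d}"
  assume "\<not> ?thesis"
  then obtain c where c: "\<exists>m\<in>?M. c m \<noteq> 0"
    "\<forall>P\<in>Z. (\<Sum>m\<in>?M. eval3 (Poly_Mapping.single m 1) P * c m) = 0"
    using underdetermined_system[OF assms(1) monomials_finite, of d "\<lambda>P m. eval3 (Poly_Mapping.single m 1) P"]
    by auto
  define f where "f = (\<Sum>m\<in>?M. Poly_Mapping.single m (c m))"
  have "homogeneous d f" unfolding f_def by (intro homogeneous_sum homogeneous_single) auto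
  moreover have "eval3 f P = (\<Sum>m\<in>?M. eval3 (Poly_Mapping.single m 1) P * c m)" for P
    unfolding f_def eval3_sum
    by (intro sum.cong) (simp_all add: eval3_eq_subst3 subst3_single[OF comm_ring_hom_id])
  ultimately have "f = 0" using c(2) by (intro unisolvent) simp_all
  moreover have "Poly_Mapping.lookup f m = (if m \<in> ?M then c m else 0)" for m
    unfolding f_def by (rule lookup_sum_single[OF monomials_finite])
  ultimately show False using c(1) by (metis lookup_zero)
qed

section \<open>Comparison of the initial degrees\<close>

theorem theorem3p1:
  fixes Z :: "('a::field_char_0 \<times> 'a \<times> 'a) set" and k :: nat
  assumes "alg_closed_field TYPE('a)"
    and "finite Z"
    and "\<forall>P\<in>Z. P \<noteq> (0, 0, 0)"
    and "\<forall>P\<in>Z. \<forall>Q\<in>Z. same_point P Q \<longrightarrow> P = Q"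
    and "k \<ge> 3"
    and "int (init_deg (ideal_fat k Z)) - int (init_deg (ideal_fat 1 Z)) = int k - 1"
  shows "collinear3 Z"
proof -
  define a where "a = init_deg (ideal_fat 1 Z)"
  have least: "\<exists>f\<in>ideal_fat j Z. f \<noteq> 0 \<and> homogeneous (init_deg (ideal_fat j Z)) f" for j
    unfolding init_deg_def by (rule LeastI_ex[OF ideal_fat_nonzero_form[OF assms(2)]])
  have nz: "P \<noteq> 0" if "P \<in> Z" for P using assms(3) that by (simp add: zero_prod_def)
  have dist: "\<nexists>c. P = scale3 c Q" if "P \<in> Z" "Q \<in> Z" "P \<noteq> Q" for P Q
  proof
    assume "\<exists>c. P = scale3 c Q"
    then obtain c where c: "P = scale3 c Q" ..
    show False
    proof (cases "c = 0")
      case True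
      then show False using c nz[OF that(1)] by (simp add: scale3_def zero_prod_def)
    next
      case False
      then have "same_point Q P" using c by (auto simp: same_point_def scale3_def)
      then show False using assms(4) that by blast
    qed
  qed
  obtain h where h: "h \<in> ideal_fat 1 Z" "h \<noteq> 0" "homogeneous a h" using least[of 1] a_def by blast
  have hZ: "eval3 h P = 0" if "P \<in> Z" for P using h homogeneous_in_ideal_fat_1_iff[OF h(3)] that by blast
  \<comment> \<open>For \<open>a = 0\<close> the set \<open>Z\<close> is empty and for
    \<open>a = 1\<close> it lies on the line \<open>h = 0\<close>; the case \<open>a \<ge> 2\<close>
    turns out to be contradictory.\<close>
  consider "a = 0" | "a = 1" | "a \<ge> 2" by linarith
  then show ?thesis
  proof cases
    case 1
    then obtain c where c: "h = Poly_Mapping.single 0 c" using homogeneous_0_const h(3) by blast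
    then have "Z = {}" using hZ h(2) eval3_const by (metis equals0I single_zero)
    then show ?thesis unfolding collinear3_def by (intro exI[of _ 1]) simp
  next
    case 2
    then obtain u where u: "h = lin u" using homogeneous_1_lin h(3) by blast
    have "u \<noteq> 0" using h(2) u by (simp add: lin_eq_0_iff)
    then show ?thesis unfolding collinear3_def
      using hZ by (intro exI[of _ "fst u"] exI[of _ "fst (snd u)"] exI[of _ "snd (snd u)"])
        (cases u, simp add: u eval3_lin dot3_def zero_prod_def)
  next
    case 3
    then obtain d where d: "a = Suc d" "d > 0" by (cases a) auto
    define unisolvent where "unisolvent = (\<lambda>Y. \<forall>f::'a poly3. homogeneous d f \<longrightarrow> (\<forall>P\<in>Y. eval3 f P = 0) \<longrightarrow> f = 0)"
    have "unisolvent Z"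
      unfolding unisolvent_def
    proof (intro allI impI, rule ccontr)
      fix f :: "'a poly3" assume f: "homogeneous d f" "\<forall>P\<in>Z. eval3 f P = 0" "f \<noteq> 0"
      then have "f \<in> ideal_fat 1 Z" using homogeneous_in_ideal_fat_1_iff by blast
      then have "init_deg (ideal_fat 1 Z) \<le> d" unfolding init_deg_def using f by (intro Least_le) blast
      then show False using d a_def by simp
    qed
    \<comment> \<open>\<open>Z\<close> has the property because \<open>d\<close> is below its
      initial degree. A minimal subset keeps it, and minimality provides every point with a
      separator of degree \<open>d\<close>.\<close>
    then obtain Y where Y: "Y \<subseteq> Z" "unisolvent Y" and min: "\<And>X. X \<subset> Y \<Longrightarrow> \<not> unisolvent X"
    proof -
      have "finite {X. X \<subseteq> Z \<and> unisolvent X}" using assms(2) by simp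
      moreover have "{X. X \<subseteq> Z \<and> unisolvent X} \<noteq> {}" using \<open>unisolvent Z\<close> by blast
      ultimately obtain Y where "Y \<in> {X. X \<subseteq> Z \<and> unisolvent X}"
        "\<forall>X\<in>{X. X \<subseteq> Z \<and> unisolvent X}. X \<subseteq> Y \<longrightarrow> Y = X"
        using finite_has_minimal[of "{X. X \<subseteq> Z \<and> unisolvent X}"] by blast
      then show thesis using that[of Y] by blast
    qed
    have finY: "finite Y" using Y(1) assms(2) finite_subset by blast
    have uni: "f = 0" if "homogeneous d f" "\<forall>P\<in>Y. eval3 f P = 0" for f
      using Y(2) that unfolding unisolvent_def by blast
    have sep: "\<exists>S. homogeneous d S \<and> eval3 S P \<noteq> 0 \<and> (\<forall>Q\<in>Y - {P}. eval3 S Q = 0)" if "P \<in> Y" for P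
    proof -
      have "\<not> unisolvent (Y - {P})" using that by (intro min) blast
      then obtain S where "homogeneous d S" "\<forall>Q\<in>Y - {P}. eval3 S Q = 0" "S \<noteq> 0"
        unfolding unisolvent_def by blast
      \<comment> \<open>If \<open>S\<close> vanished at \<open>P\<close> too, unisolvence of
        \<open>Y\<close> would make it zero.\<close>
      then show ?thesis using uni[of S] by blast
    qed
    obtain F where F: "F \<in> ideal_fat k Z" "F \<noteq> 0" "homogeneous (init_deg (ideal_fat k Z)) F"
      using least by blast
    have deg: "init_deg (ideal_fat k Z) = d + k" using assms(5,6) d a_def by simp
    have "vanish k P F" if "P \<in> Y" for P
      using F(1) Y(1) that unfolding ideal_fat_def by (intro ideal_pow_vanish) blast
    then have "(\<Sum>P\<in>Y. k) \<le> Suc d * init_deg (ideal_fat k Z)"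
      using Y(1) nz dist
      by (intro multiplicity_bound[OF assms(1) finY _ _ d(2) uni sep F(2,3)]) blast+
    then have "k * card Y \<le> Suc d * (d + k)" by (simp add: deg mult.commute)
    moreover have "k * (2 * card {m. mdeg m = d}) \<le> k * (2 * card Y)"
      using unisolvent_card[OF finY uni] by simp
    ultimately have "k * ((d + 1) * (d + 2)) \<le> 2 * (Suc d * (d + k))"
      unfolding card_monomials by simp
    \<comment> \<open>After cancelling \<open>d + 1\<close> this is (k - 2) d \<le> 0, which is
      impossible for \<open>k \<ge> 3\<close> and \<open>d > 0\<close>.\<close>
    then have "Suc d * (k * (d + 2)) \<le> Suc d * (2 * (d + k))" by (simp add: algebra_simps)
    then have "k * (d + 2) \<le> 2 * (d + k)" by (simp only: mult_le_cancel1)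
    then have "k * d \<le> 2 * d" by (simp add: algebra_simps)
    then show ?thesis using d(2) assms(5) by simp
  qed
qed

end
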